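(* Suppose $A_n=\{1,2\}$ with sequences $\varepsilon_{n,1}>\varepsilon_{n,2}$, and that there are constants $E_1,E_2>0$ such that for $\alpha\in\{1,2\}$, $$\sup_{\varepsilon\ge\varepsilon_{n,\alpha}}\log N\Big(\frac\varepsilon3,C_{n,\alpha}(2\varepsilon),d\Big)\le E_\alpha n\varepsilon_{n,\alpha}^2 .$$ (1) If $\Pi_{n,1}(B_{n,1}(\varepsilon_{n,1}))\ge e^{-n\varepsilon_{n,1}^2}$ and $\lambda_{n,2}/\lambda_{n,1}\le e^{n\varepsilon_{n,1}^2}$ and $d(p_0,\mathcal P_{n,2})\ge I_n\varepsilon_{n,1}$ for every $n$ and some $I_n\to\infty$, then $\mathrm{BF}_n\to0$ in $P_0^n$-probability. (2) If $\Pi_{n,2}(B_{n,2}(\varepsilon_{n,2}))\ge e^{-n\varepsilon_{n,2}^2}$ and $\lambda_{n,2}/\lambda_{n,1}\ge e^{-n\varepsilon_{n,1}^2}$ and $\Pi_{n,1}(C_{n,1}(I\varepsilon_{n,1}))\le(\lambda_{n,2}/\lambda_{n,1})\,o(e^{-3n\varepsilon_{n,2}^2})$ for every constant $I$, then $\mathrm{BF}_n\to\infty$ in $P_0^n$-probability.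
   Context: Setting. $X_1,\dots,X_n$ is an i.i.d. sample from a probability measure $P_0$ on a measurable space $(\mathcal X,\mathcal A)$ with density $p_0$ relative to a reference measure $\mu$; $P_0f=\int f\,dP_0$. The Hellinger distance is $h(p,q)=\|\sqrt p-\sqrt q\|_2$ (norm of $L_2(\mu)$). $d$ is a metric on the set of probability densities that is bounded above by $h$ and whose balls are convex; $d(p_0,\mathcal P)=\inf_{p\in\mathcal P}d(p_0,p)$. $N(\varepsilon,\mathcal P,d)$ is the $\varepsilon$-covering number of the metric space $(\mathcal P,d)$: the minimal number of balls of radius $\varepsilon$ needed to cover $\mathcal P$. For each $n$ and $\alpha\in A_n$, $\mathcal P_{n,\alpha}$ is a set of $\mu$-probability densities with a $\sigma$-field making $(x,p)\mapsto p(x)$ measurable, and $\Pi_{n,\alpha}$ is a (prior) probability measure on $\mathcal P_{n,\alpha}$; $(\lambda_{n,1},\lambda_{n,2})$ is a probability vector of prior model weights. $\varepsilon_{n,\alpha}>0$ are given numbers with $\varepsilon_{n,\alpha}\to0$ as $n\to\infty$. Neighbourhoods: $$B_{n,\alpha}(\varepsilon)=\Big\{p\in\mathcal P_{n,\alpha}:-P_0\log\frac p{p_0}\le\varepsilon^2,\ P_0\Big(\log\frac p{p_0}\Big)^2\le\varepsilon^2\Big\},\quad C_{n,\alpha}(\varepsilon)=\{p\in\mathcal P_{n,\alpha}:d(p,p_0)\le\varepsilon\}.$$ The Bayes factor is $$\mathrm{BF}_n=\frac{\lambda_{n,2}\int\prod_{i=1}^np(X_i)\,d\Pi_{n,2}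(p)}{\lambda_{n,1}\int\prod_{i=1}^np(X_i)\,d\Pi_{n,1}(p)}.$$
   Formalization: It is additionally assumed that there is a constant c>0 with n·ε_{n,1}² ≥ c for all n ≥ 1; without it both parts fail, e.g. one-point models at Hellinger distance of order n^{-3/2} with ε_{n,1}=n^{-2}/2, where BF_n→1. *)

theory Defs
  imports "HOL-Probability.Probability" "HOL-Library.Landau_Symbols"
begin

definition prob_densities :: "'a measure \<Rightarrow> ('a \<Rightarrow> real) set" where
  "prob_densities \<mu> =
     {p \<in> borel_measurable \<mu>. (\<forall>x\<in>space \<mu>. 0 \<le> p x) \<and> (\<integral>\<^sup>+x. ennreal (p x) \<partial>\<mu>) = 1}"

definition hellinger :: "'a measure \<Rightarrow> ('a \<Rightarrow> real) \<Rightarrow> ('a \<Rightarrow> real) \<Rightarrow> real" where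
  "hellinger \<mu> p q = sqrt (\<integral>x. (sqrt (p x) - sqrt (q x))\<^sup>2 \<partial>\<mu>)"

text \<open>
  Densities are represented by functions, and two densities are the same point when they agree
  almost everywhere. So a metric on densities is a pseudometric on the representing functions
  that vanishes exactly on pairs that agree almost everywhere. (No \<^emph>\<open>d\<close> with
  \<^emph>\<open>d\<close> at most the Hellinger distance can separate functions that agree almost everywhere.)
\<close>
definition density_metric ::
  "'a measure \<Rightarrow> (('a \<Rightarrow> real) \<Rightarrow> ('a \<Rightarrow> real) \<Rightarrow> real) \<Rightarrow> bool" where
  "density_metric \<mu> d \<longleftrightarrow>
     (\<forall>p\<in>prob_densities \<mu>. \<forall>q\<in>prob_densities \<mu>.
        0 \<le> d p q \<and>
        (d p q = 0 \<longleftrightarrow> (AE x in \<mu>. p x = q x)) \<and>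
        d p q = d q p \<and>
        (\<forall>r\<in>prob_densities \<mu>. d p r \<le> d p q + d q r))"

text \<open>
  Convexity of the open balls; since closed balls are intersections, and open balls increasing
  unions, of balls of the other kind, this is the same as convexity of the closed balls.
\<close>
definition convex_balls ::
  "'a measure \<Rightarrow> (('a \<Rightarrow> real) \<Rightarrow> ('a \<Rightarrow> real) \<Rightarrow> real) \<Rightarrow> bool" where
  "convex_balls \<mu> d \<longleftrightarrow>
     (\<forall>c\<in>prob_densities \<mu>. \<forall>r>0. \<forall>p\<in>prob_densities \<mu>. \<forall>q\<in>prob_densities \<mu>.
        d c p < r \<longrightarrow> d c q < r \<longrightarrow>
        (\<forall>t\<in>{0..1}. d c (\<lambda>x. (1 - t) * p x + t * q x) < r))"

definition dist_to_set :: "('b \<Rightarrow> 'b \<Rightarrow> real) \<Rightarrow> 'b \<Rightarrow> 'b set \<Rightarrow> real" where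
  "dist_to_set d p S = (INF q\<in>S. d p q)"

text \<open>
  Covering number of the metric space \<^emph>\<open>(S, d)\<close>: open balls of that space, hence with centres
  in \<^emph>\<open>S\<close>. It is infinite if there is no finite cover.
\<close>
definition covering_number :: "real \<Rightarrow> 'b set \<Rightarrow> ('b \<Rightarrow> 'b \<Rightarrow> real) \<Rightarrow> enat" where
  "covering_number \<epsilon> S d =
     (INF F \<in> {F. finite F \<and> F \<subseteq> S \<and> S \<subseteq> (\<Union>c\<in>F. {p \<in> S. d c p < \<epsilon>})}. enat (card F))"

definition ln_enat :: "enat \<Rightarrow> ereal" where
  "ln_enat N = (case N of enat k \<Rightarrow> if k = 0 then - \<infinity> else ereal (ln (real k)) | \<infinity> \<Rightarrow> \<infinity>)"

text \<open>
  In the mathematical definition the logarithm of 0 is minus infinity and its square is infinity,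
  whereas \<^term>\<open>ln (0::real)\<close> is 0: hence the explicit almost sure positivity.
  Finiteness of the second moment (a nonnegative integral) makes the logarithm integrable, so that
  the Bochner integral in the first moment is the true one.
\<close>
definition KL_nbhd ::
  "'a measure \<Rightarrow> ('a \<Rightarrow> real) \<Rightarrow> ('a \<Rightarrow> real) set \<Rightarrow> real \<Rightarrow> ('a \<Rightarrow> real) set" where
  "KL_nbhd \<mu> p0 P \<epsilon> =
     {p \<in> P. (AE x in density \<mu> p0. 0 < p x) \<and>
        - (\<integral>x. ln (p x / p0 x) \<partial>(density \<mu> p0)) \<le> \<epsilon>\<^sup>2 \<and>
        (\<integral>\<^sup>+x. ennreal ((ln (p x / p0 x))\<^sup>2) \<partial>(density \<mu> p0)) \<le> ennreal (\<epsilon>\<^sup>2)}"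

definition metric_nbhd :: "('b \<Rightarrow> 'b \<Rightarrow> real) \<Rightarrow> 'b \<Rightarrow> 'b set \<Rightarrow> real \<Rightarrow> 'b set" where
  "metric_nbhd d p0 P \<epsilon> = {p \<in> P. d p p0 \<le> \<epsilon>}"

definition sample_measure :: "'a measure \<Rightarrow> ('a \<Rightarrow> real) \<Rightarrow> nat \<Rightarrow> (nat \<Rightarrow> 'a) measure" where
  "sample_measure \<mu> p0 n = PiM {..<n} (\<lambda>_. density \<mu> p0)"

definition marginal_likelihood ::
  "('a \<Rightarrow> real) measure \<Rightarrow> nat \<Rightarrow> (nat \<Rightarrow> 'a) \<Rightarrow> ennreal" where
  "marginal_likelihood \<pi> n x = (\<integral>\<^sup>+p. ennreal (\<Prod>i<n. p (x i)) \<partial>\<pi>)"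

text \<open>
  Odds and Bayes factor are \<^typ>\<open>ennreal\<close>-valued, so that \<^term>\<open>a / (0::ennreal)\<close> is infinite
  for nonzero \<^emph>\<open>a\<close>: a vanishing denominator must not make them zero, as it would in the reals.
\<close>
definition prior_odds :: "(nat \<Rightarrow> real) \<Rightarrow> ennreal" where
  "prior_odds w = ennreal (w 2) / ennreal (w 1)"

definition bayes_factor ::
  "(nat \<Rightarrow> real) \<Rightarrow> (nat \<Rightarrow> ('a \<Rightarrow> real) measure) \<Rightarrow> nat \<Rightarrow> (nat \<Rightarrow> 'a) \<Rightarrow> ennreal" where
  "bayes_factor w \<pi> n x =
     (ennreal (w 2) * marginal_likelihood (\<pi> 2) n x) /
     (ennreal (w 1) * marginal_likelihood (\<pi> 1) n x)"

definition tendsto_zero_in_prob ::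
  "(nat \<Rightarrow> 'b measure) \<Rightarrow> (nat \<Rightarrow> 'b \<Rightarrow> ennreal) \<Rightarrow> bool" where
  "tendsto_zero_in_prob Q Y \<longleftrightarrow>
     (\<forall>\<eta>::real. \<eta> > 0 \<longrightarrow>
        (\<lambda>n. measure (Q n) {x \<in> space (Q n). Y n x < ennreal \<eta>}) \<longlonglongrightarrow> 1)"

definition tendsto_infinity_in_prob ::
  "(nat \<Rightarrow> 'b measure) \<Rightarrow> (nat \<Rightarrow> 'b \<Rightarrow> ennreal) \<Rightarrow> bool" where
  "tendsto_infinity_in_prob Q Y \<longleftrightarrow>
     (\<forall>K::real. (\<lambda>n. measure (Q n) {x \<in> space (Q n). Y n x > ennreal K}) \<longlonglongrightarrow> 1)"

end

theory Submission
  imports Defs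
begin

text \<open>
  Work with likelihood ratios \<open>p / p0\<close> under the null. A ball of the metric that keeps a distance \<open>r\<close>
  from \<open>p0\<close> is convex, so it has a Hellinger projection \<open>q\<close>, and the first-order condition for \<open>q\<close>
  says that the single test \<open>\<Prod>i<n. q (X i) / p0 (X i) > 1\<close> has both errors at most
  \<open>exp (- n r\<^sup>2 / 2)\<close>, uniformly over the ball; no minimax theorem is needed. Covering dyadic shells around
  \<open>p0\<close> by balls gives a test of \<open>p0\<close> against everything at distance at least \<open>\<delta>\<close> in a model, which
  bounds the marginal likelihood of the far part of that model in expectation. The
  Kullback-Leibler condition bounds the marginal likelihood of the other model from below in probability.
\<close>

text \<open>Maximising the affinity \<open>\<integral> sqrt v\<close> over a convex class is what
  makes one test serve the whole class: extremality bounds \<open>\<integral> v / u\<close> by the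
  maximal affinity, for every \<open>v\<close> at once. The maximum need not be attained in the
  class, so it is approached along a sequence and each estimate passes to the limit by Fatou. Since
  \<open>u\<close> may vanish, quotients live in \<open>ennreal\<close>, where a finite integral of
  \<open>v / u\<close> excludes \<open>u = 0 < v\<close> almost everywhere. The constants come from
  one competition of exponents. Put \<open>x = real n * (eps n 1)\<^sup>2\<close>. The test gains
  \<open>b = real n * \<delta>\<^sup>2 / 18\<close> and has to pay the entropy, at most
  \<open>E * x\<close>; at most \<open>3 * x\<close> for the evidence of the other model (two for
  the Kullback-Leibler deviation, one for its prior mass); and at most \<open>x\<close> for the
  prior odds. As \<open>x\<close> is only known to be at least \<open>c\<close> and need not grow,
  smallness comes from a surplus \<open>L * x \<ge> L * c\<close> obtained by enlarging the radius,
  and from the free constant \<open>K\<close>; both are fixed before \<open>n\<close>.\<close>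

section \<open>Hellinger projection onto a convex class\<close>

text \<open>A quantitative strict concavity of the square root: the squared difference factors as
  four times (gap) times (midpoint root plus mean root), and the last factor is at most 3/2 of the
  sum of the roots. The weight \<open>\<kappa>\<close> splits the resulting geometric mean into two
  terms, both linear in functions whose integrals are controlled, so that near-maximisers of the
  affinity are close in L1.\<close>

lemma sqrt_midpoint_gap:
  fixes a b \<kappa> :: real
  assumes "0 \<le> a" "0 \<le> b" "0 < \<kappa>"
  shows "\<bar>sqrt a - sqrt b\<bar> \<le>
    6 / \<kappa> * (sqrt ((a + b) / 2) - (sqrt a + sqrt b) / 2) + \<kappa> / 4 * (sqrt a + sqrt b)"
proof -
  define s t m where "s = sqrt a" and "t = sqrt b" and "m = sqrt ((a + b) / 2)"
  have st: "0 \<le> s" "0 \<le> t" "0 \<le> m" "a = s\<^sup>2" "b = t\<^sup>2" "m\<^sup>2 = (s\<^sup>2 + t\<^sup>2) / 2"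
    using assms by (auto simp: s_def t_def m_def)
  have m_le: "m \<le> s + t"
  proof (rule power2_le_imp_le)
    have "0 \<le> s\<^sup>2 + t\<^sup>2 + 4 * (s * t)" using st by simp
    then show "m\<^sup>2 \<le> (s + t)\<^sup>2"
      unfolding st(6) by (simp add: field_simps power2_eq_square)
  qed (use st in auto)
  have gap: "(m - (s + t) / 2) * (m + (s + t) / 2) = (s - t)\<^sup>2 / 4"
    using st by (simp add: field_simps power2_eq_square)
  have m_ge: "(s + t) / 2 \<le> m"
  proof (rule power2_le_imp_le)
    have "0 \<le> (s - t)\<^sup>2" by simp
    then show "((s + t) / 2)\<^sup>2 \<le> m\<^sup>2"
      using st by (simp add: field_simps power2_eq_square)
  qed (use st in auto)
  have "(s - t)\<^sup>2 / 4 \<le> (m - (s + t) / 2) * (3 * (s + t) / 2)"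
    unfolding gap[symmetric]
  proof (rule mult_left_mono)
    show "m + (s + t) / 2 \<le> 3 * (s + t) / 2" using m_le by argo
    show "0 \<le> m - (s + t) / 2" using m_ge by argo
  qed
  then have *: "(s - t)\<^sup>2 \<le> 6 * (m - (s + t) / 2) * (s + t)"
    by (simp add: field_simps)
  have "\<bar>s - t\<bar> \<le> 6 / \<kappa> * (m - (s + t) / 2) + \<kappa> / 4 * (s + t)" (is "_ \<le> ?A + ?B")
  proof (rule power2_le_imp_le)
    have "4 * ?A * ?B = 6 * (m - (s + t) / 2) * (s + t)"
      using \<open>0 < \<kappa>\<close> by (simp add: field_simps)
    then have "\<bar>s - t\<bar>\<^sup>2 \<le> 4 * ?A * ?B"
      using * by simp
    also have "\<dots> \<le> (?A + ?B)\<^sup>2"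
    proof -
      have "0 \<le> (x - y)\<^sup>2 \<longleftrightarrow> 4 * x * y \<le> (x + y)\<^sup>2" for x y :: real
        by (simp add: power2_eq_square algebra_simps)
      then show ?thesis by (metis zero_le_power2)
    qed
    finally show "\<bar>s - t\<bar>\<^sup>2 \<le> (?A + ?B)\<^sup>2" .
    show "0 \<le> ?A + ?B"
      using m_ge st \<open>0 < \<kappa>\<close> by (intro add_nonneg_nonneg mult_nonneg_nonneg) auto
  qed
  then show ?thesis
    by (simp add: s_def t_def m_def)
qed

lemma (in prob_space) integrable_sqrt_of_integral_le_1:
  assumes [measurable]: "v \<in> borel_measurable M" and "\<And>x. x \<in> space M \<Longrightarrow> 0 \<le> v x" and "(\<integral>\<^sup>+x. ennreal (v x) \<partial>M) \<le> 1"
  shows "integrable M (\<lambda>x. sqrt (v x))" and "(\<integral>x. sqrt (v x) \<partial>M) \<le> 1"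
proof -
  have *: "sqrt t \<le> (1 + t) / 2" if "0 \<le> t" for t :: real
    using arith_geo_mean_sqrt[of 1 t] that by simp
  have v: "integrable M v"
    by (rule integrableI_nonneg) (use assms in \<open>auto simp: order_le_less_trans\<close>)
  have v1: "(\<integral>x. v x \<partial>M) \<le> 1"
    using assms by (subst integral_eq_nn_integral) (auto intro!: enn2real_leI)
  show I: "integrable M (\<lambda>x. sqrt (v x))"
    by (rule Bochner_Integration.integrable_bound[where f="\<lambda>x. (1 + v x) / 2"]) (use v assms * in auto)
  have "(\<integral>x. sqrt (v x) \<partial>M) \<le> (\<integral>x. (1 + v x) / 2 \<partial>M)"
    by (rule integral_mono) (use I v * assms in auto)
  also have "\<dots> \<le> 1"
    using v v1 by (simp add: prob_space)
  finally show "(\<integral>x. sqrt (v x) \<partial>M) \<le> 1" .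
qed

text \<open>Increments summable in L1 make the telescoping series converge absolutely almost
  everywhere, so the given sequence itself converges pointwise, without passing to a subsequence,
  and integrals pass to the limit.\<close>

lemma (in prob_space) L1_fast_Cauchy_limit:
  fixes u :: "nat \<Rightarrow> 'a \<Rightarrow> real"
  assumes int: "\<And>k. integrable M (u k)"
    and fast: "\<And>k. (\<integral>x. \<bar>u (Suc k) x - u k x\<bar> \<partial>M) \<le> C * (1 / 2) ^ k"
    and lim: "(\<lambda>k. \<integral>x. u k x \<partial>M) \<longlonglongrightarrow> L"
  obtains g where "integrable M g" "AE x in M. (\<lambda>k. u k x) \<longlonglongrightarrow> g x" "(\<integral>x. g x \<partial>M) = L"
proof -
  define f where "f k x = u (Suc k) x - u k x" for k x
  have f: "integrable M (f k)" for k
    unfolding f_def using int by auto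
  have sumC: "summable (\<lambda>k. C * (1 / 2) ^ k :: real)"
    by (intro summable_mult summable_geometric) auto
  have sum_int: "summable (\<lambda>k. \<integral>x. norm (f k x) \<partial>M)"
    by (rule summable_comparison_test'[OF sumC, of 0]) (use fast in \<open>auto simp: f_def\<close>)
  have "(\<integral>\<^sup>+x. (\<Sum>k. ennreal \<bar>f k x\<bar>) \<partial>M) = (\<Sum>k. \<integral>\<^sup>+x. ennreal \<bar>f k x\<bar> \<partial>M)"
    using f by (intro nn_integral_suminf) auto
  also have "\<dots> = (\<Sum>k. ennreal (\<integral>x. \<bar>f k x\<bar> \<partial>M))"
    using f by (intro suminf_cong nn_integral_eq_integral) auto
  also have "\<dots> \<noteq> \<infinity>"
    using sum_int by (subst suminf_ennreal2) auto
  finally have "AE x in M. (\<Sum>k. ennreal \<bar>f k x\<bar>) \<noteq> \<infinity>"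
    using f by (intro nn_integral_PInf_AE) auto
  then have sum_AE: "AE x in M. summable (\<lambda>k. norm (f k x))"
    by eventually_elim (auto intro: summable_suminf_not_top)
  define g where "g x = (\<Sum>k. f k x) + u 0 x" for x
  have tele: "(\<Sum>k<n. f k x) = u n x - u 0 x" for n x
    unfolding f_def by (rule sum_lessThan_telescope)
  show thesis
  proof
    show "integrable M g"
      unfolding g_def using integrable_suminf[OF f sum_AE sum_int] int by auto
    show "AE x in M. (\<lambda>k. u k x) \<longlonglongrightarrow> g x"
      using sum_AE
    proof eventually_elim
      case (elim x)
      then have "(\<lambda>n. \<Sum>k<n. f k x) \<longlonglongrightarrow> (\<Sum>k. f k x)"
        by (intro summable_LIMSEQ) (rule summable_norm_cancel)
      from tendsto_add[OF this tendsto_const[of "u 0 x"]] show ?case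
        by (simp add: tele g_def)
    qed
    have "(\<lambda>n. \<Sum>k<n. \<integral>x. f k x \<partial>M) \<longlonglongrightarrow> (\<integral>x. (\<Sum>k. f k x) \<partial>M)"
      using sums_integral[OF f sum_AE sum_int] by (simp add: sums_def)
    moreover have "(\<Sum>k<n. \<integral>x. f k x \<partial>M) = (\<integral>x. u n x \<partial>M) - (\<integral>x. u 0 x \<partial>M)" for n
      using sum_lessThan_telescope[of "\<lambda>k. \<integral>x. u k x \<partial>M" n] int
      by (simp add: f_def Bochner_Integration.integral_diff)
    ultimately have "(\<lambda>n. (\<integral>x. u n x \<partial>M) - (\<integral>x. u 0 x \<partial>M)) \<longlonglongrightarrow> (\<integral>x. (\<Sum>k. f k x) \<partial>M)"
      by simp
    moreover have "(\<lambda>n. (\<integral>x. u n x \<partial>M) - (\<integral>x. u 0 x \<partial>M)) \<longlonglongrightarrow> L - (\<integral>x. u 0 x \<partial>M)"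
      by (intro tendsto_intros lim)
    ultimately have "(\<integral>x. (\<Sum>k. f k x) \<partial>M) = L - (\<integral>x. u 0 x \<partial>M)"
      by (rule LIMSEQ_unique)
    then show "(\<integral>x. g x \<partial>M) = L"
      unfolding g_def using integrable_suminf[OF f sum_AE sum_int] int by simp
  qed
qed

text \<open>
  Writing \<^term>\<open>v = p / p0\<close>, the function \<^term>\<open>u\<close> is \<open>sqrt (q / p0)\<close> for the element \<open>q\<close> of the
  closure of the class that is Hellinger-closest to \<open>p0\<close>; the second bound is the first-order
  condition for this extremum in the direction of \<^term>\<open>v\<close>.
\<close>
lemma (in prob_space) hellinger_projection:
  fixes V :: "('a \<Rightarrow> real) set"
  assumes ne: "V \<noteq> {}"
    and meas: "\<And>v. v \<in> V \<Longrightarrow> v \<in> borel_measurable M"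
    and nonneg: "\<And>v x. v \<in> V \<Longrightarrow> x \<in> space M \<Longrightarrow> 0 \<le> v x"
    and mass: "\<And>v. v \<in> V \<Longrightarrow> (\<integral>\<^sup>+x. ennreal (v x) \<partial>M) \<le> 1"
    and conv: "\<And>v w t. v \<in> V \<Longrightarrow> w \<in> V \<Longrightarrow> 0 \<le> t \<Longrightarrow> t \<le> 1 \<Longrightarrow> (\<lambda>x. (1 - t) * v x + t * w x) \<in> V"
    and R: "\<And>v. v \<in> V \<Longrightarrow> (\<integral>x. sqrt (v x) \<partial>M) \<le> R"
  obtains u where "u \<in> borel_measurable M" "\<And>x. 0 \<le> u x" "(\<integral>\<^sup>+x. ennreal (u x) \<partial>M) \<le> ennreal R"
    "\<And>v. v \<in> V \<Longrightarrow> (\<integral>\<^sup>+x. ennreal (v x) / ennreal (u x) \<partial>M) \<le> ennreal R"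
proof -
  \<comment> \<open>The first-order condition needs the exact supremum; the given bound
    \<open>R\<close> replaces it only at the very end.\<close>
  define R0 where "R0 = (SUP v\<in>V. \<integral>x. sqrt (v x) \<partial>M)"
  have int_sqrt: "integrable M (\<lambda>x. sqrt (v x))" "(\<integral>x. sqrt (v x) \<partial>M) \<le> 1" if "v \<in> V" for v
    using integrable_sqrt_of_integral_le_1[OF meas[OF that] nonneg[OF that] mass[OF that]] by auto
  have bdd: "bdd_above ((\<lambda>v. \<integral>x. sqrt (v x) \<partial>M) ` V)"
    using R by (intro bdd_aboveI2)
  have le_R0: "(\<integral>x. sqrt (v x) \<partial>M) \<le> R0" if "v \<in> V" for v
    unfolding R0_def by (rule cSUP_upper[OF that bdd])
  have R0_le: "R0 \<le> R" "R0 \<le> 1"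
    unfolding R0_def using ne R int_sqrt(2) by (auto intro!: cSUP_least)
  have R0_nonneg: "0 \<le> R0"
  proof -
    obtain v where v: "v \<in> V" using ne by auto
    have "0 \<le> (\<integral>x. sqrt (v x) \<partial>M)" using nonneg[OF v] by (intro Bochner_Integration.integral_nonneg) auto
    with le_R0[OF v] show ?thesis by simp
  qed
  have "\<exists>v\<in>V. R0 - (1 / 4) ^ k < (\<integral>x. sqrt (v x) \<partial>M)" for k :: nat
    using less_cSUP_iff[OF ne bdd, of "R0 - (1 / 4) ^ k"] by (simp add: R0_def)
  then obtain w where w: "\<And>k. w k \<in> V" and w_lt: "\<And>k. R0 - (1 / 4) ^ k < (\<integral>x. sqrt (w k x) \<partial>M)"
    by metis
  note w_meas[measurable] = meas[OF w]
  have w_int: "integrable M (\<lambda>x. sqrt (w k x))" for k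
    by (rule int_sqrt(1)[OF w])
  \<comment> \<open>The midpoint of two near-maximisers lies in \<open>V\<close>, so its affinity is
    at most \<open>R0\<close> and the integrated concavity gap is at most
    \<open>(1 / 4) ^ k\<close>. The choice \<open>\<kappa> = (1 / 2) ^ k\<close> balances the two
    terms of \<open>sqrt_midpoint_gap\<close> at order \<open>(1 / 2) ^ k\<close>; this is why the
    accuracy of \<open>w k\<close> was taken to be the square of that rate.\<close>
  have fast: "(\<integral>x. \<bar>sqrt (w (Suc k) x) - sqrt (w k x)\<bar> \<partial>M) \<le> 7 * (1 / 2) ^ k" for k
  proof -
    let ?\<kappa> = "(1 / 2) ^ k :: real"
    let ?m = "\<lambda>x. (1 - 1 / 2) * w (Suc k) x + 1 / 2 * w k x"
    have m: "?m \<in> V" by (rule conv[OF w w]) auto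
    have m_int: "integrable M (\<lambda>x. sqrt (?m x))" by (rule int_sqrt(1)[OF m])
    have "(\<integral>x. \<bar>sqrt (w (Suc k) x) - sqrt (w k x)\<bar> \<partial>M) \<le>
      (\<integral>x. 6 / ?\<kappa> * (sqrt (?m x) - (sqrt (w (Suc k) x) + sqrt (w k x)) / 2)
          + ?\<kappa> / 4 * (sqrt (w (Suc k) x) + sqrt (w k x)) \<partial>M)"
    proof (rule integral_mono)
      fix x assume "x \<in> space M"
      then show "\<bar>sqrt (w (Suc k) x) - sqrt (w k x)\<bar> \<le> 6 / ?\<kappa> * (sqrt (?m x) - (sqrt (w (Suc k) x) + sqrt (w k x)) / 2)
          + ?\<kappa> / 4 * (sqrt (w (Suc k) x) + sqrt (w k x))"
        using sqrt_midpoint_gap[of "w (Suc k) x" "w k x" ?\<kappa>] nonneg[OF w]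
        by (simp add: field_simps)
    qed (use w_int m_int in auto)
    also have "\<dots> = 6 / ?\<kappa> * ((\<integral>x. sqrt (?m x) \<partial>M) - ((\<integral>x. sqrt (w (Suc k) x) \<partial>M) + (\<integral>x. sqrt (w k x) \<partial>M)) / 2)
          + ?\<kappa> / 4 * ((\<integral>x. sqrt (w (Suc k) x) \<partial>M) + (\<integral>x. sqrt (w k x) \<partial>M))"
      using w_int m_int by simp
    also have "\<dots> \<le> 6 / ?\<kappa> * (1 / 4) ^ k + ?\<kappa> / 4 * 2"
    proof (intro add_mono mult_left_mono)
      have "(1 / 4) ^ Suc k \<le> (1 / 4 :: real) ^ k" by simp
      then show "(\<integral>x. sqrt (?m x) \<partial>M) - ((\<integral>x. sqrt (w (Suc k) x) \<partial>M) + (\<integral>x. sqrt (w k x) \<partial>M)) / 2 \<le> (1 / 4) ^ k"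
        using le_R0[OF m] w_lt[of k] w_lt[of "Suc k"] by argo
      show "(\<integral>x. sqrt (w (Suc k) x) \<partial>M) + (\<integral>x. sqrt (w k x) \<partial>M) \<le> 2"
        using le_R0[OF w, of k] le_R0[OF w, of "Suc k"] R0_le by simp
    qed auto
    also have "6 / ?\<kappa> * (1 / 4) ^ k = 6 * (1 / 2) ^ k"
      by (simp add: field_simps flip: power_mult_distrib)
    finally show ?thesis
      using zero_le_power[of "1 / 2 :: real" k] by linarith
  qed
  have lim: "(\<lambda>k. \<integral>x. sqrt (w k x) \<partial>M) \<longlonglongrightarrow> R0"
  proof (rule tendsto_sandwich[OF _ _ _ tendsto_const])
    show "(\<lambda>k. R0 - (1 / 4) ^ k) \<longlonglongrightarrow> R0"
      by (auto intro!: tendsto_eq_intros LIMSEQ_realpow_zero)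
  qed (use w_lt le_R0[OF w] in \<open>auto intro!: always_eventually simp: less_imp_le\<close>)
  obtain g where g: "integrable M g" "AE x in M. (\<lambda>k. sqrt (w k x)) \<longlonglongrightarrow> g x" "(\<integral>x. g x \<partial>M) = R0"
    using L1_fast_Cauchy_limit[OF w_int fast lim] by blast
  have g_meas[measurable]: "g \<in> borel_measurable M" using g(1) by auto
  have g_nonneg: "AE x in M. 0 \<le> g x"
    using g(2) AE_space
  proof eventually_elim
    case (elim x)
    show ?case by (rule LIMSEQ_le_const[OF elim(1)]) (use nonneg[OF w elim(2)] in auto)
  qed
  \<comment> \<open>Truncation changes nothing almost everywhere and makes \<open>u\<close>
    nonnegative at every point. Its square is the limit of the \<open>w k\<close> and may lie
    outside \<open>V\<close>.\<close>
  define u where "u x = max 0 (g x)" for x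
  have u_meas[measurable]: "u \<in> borel_measurable M" unfolding u_def by measurable
  have u_g: "AE x in M. u x = g x"
    using g_nonneg by eventually_elim (auto simp: u_def)
  have u_nonneg: "0 \<le> u x" for x by (simp add: u_def)
  have u_int: "integrable M u" using g(1) u_g by (subst integrable_cong_AE) auto
  have u_R0: "(\<integral>x. u x \<partial>M) = R0" using g(3) integral_cong_AE[OF u_meas g_meas u_g] by simp
  have u_lim: "AE x in M. (\<lambda>k. w k x) \<longlonglongrightarrow> (u x)\<^sup>2"
    using g(2) u_g AE_space
  proof eventually_elim
    case (elim x)
    have "(\<lambda>k. (sqrt (w k x))\<^sup>2) \<longlonglongrightarrow> (u x)\<^sup>2"
      using elim by (intro tendsto_power) simp
    then show ?case using nonneg[OF w elim(3)] by simp
  qed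
  have first_order: "(\<integral>\<^sup>+x. ennreal (v x) / ennreal (u x) \<partial>M) \<le> ennreal R0" if v: "v \<in> V" for v
  proof -
    note [measurable] = meas[OF v]
    \<comment> \<open>An unnormalised perturbation of the extremal element in direction
      \<open>v\<close>. Along the sequence, \<open>w k + s * v\<close> is \<open>1 + s\<close> times
      a convex combination inside \<open>V\<close>, so its affinity is at most
      \<open>R0 * sqrt (1 + s)\<close>; Fatou transfers this to \<open>F s\<close>.\<close>
    define F where "F s x = sqrt ((u x)\<^sup>2 + s * v x)" for s x
    have F_meas[measurable]: "F s \<in> borel_measurable M" for s unfolding F_def by measurable
    have F_le: "(\<integral>\<^sup>+x. ennreal (F s x) \<partial>M) \<le> ennreal (R0 * sqrt (1 + s))" if s: "0 < s" for s
    proof -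
      have "(\<integral>\<^sup>+x. ennreal (F s x) \<partial>M) = (\<integral>\<^sup>+x. liminf (\<lambda>k. ennreal (sqrt (w k x + s * v x))) \<partial>M)"
      proof (rule nn_integral_cong_AE)
        show "AE x in M. ennreal (F s x) = liminf (\<lambda>k. ennreal (sqrt (w k x + s * v x)))"
          using u_lim
        proof eventually_elim
          case (elim x)
          have "(\<lambda>k. ennreal (sqrt (w k x + s * v x))) \<longlonglongrightarrow> ennreal (F s x)"
            unfolding F_def by (intro tendsto_intros elim)
          from lim_imp_Liminf[OF _ this] show ?case by simp
        qed
      qed
      also have "\<dots> \<le> liminf (\<lambda>k. \<integral>\<^sup>+x. ennreal (sqrt (w k x + s * v x)) \<partial>M)"
        by (rule nn_integral_liminf) measurable
      also have "\<dots> \<le> ennreal (R0 * sqrt (1 + s))"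
      proof (rule Liminf_le[OF sequentially_bot], rule always_eventually, rule allI)
        fix k
        let ?m = "\<lambda>x. (1 - s / (1 + s)) * w k x + s / (1 + s) * v x"
        have m: "?m \<in> V" by (rule conv[OF w v]) (use s in auto)
        have eq: "sqrt (w k x + s * v x) = sqrt (1 + s) * sqrt (?m x)" for x
        proof -
          have "w k x + s * v x = (1 + s) * ?m x"
            using s by (simp add: divide_simps)
          then show ?thesis by (simp only: real_sqrt_mult)
        qed
        have m_int: "integrable M (\<lambda>x. sqrt (?m x))" by (rule int_sqrt(1)[OF m])
        have "(\<integral>\<^sup>+x. ennreal (sqrt (w k x + s * v x)) \<partial>M) = ennreal (\<integral>x. sqrt (1 + s) * sqrt (?m x) \<partial>M)"
          unfolding eq
          by (rule nn_integral_eq_integral) (use m_int nonneg[OF m] s in auto)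
        also have "\<dots> \<le> ennreal (R0 * sqrt (1 + s))"
          using le_R0[OF m] s by (intro ennreal_leI) (simp add: mult.commute mult_left_mono)
        finally show "(\<integral>\<^sup>+x. ennreal (sqrt (w k x + s * v x)) \<partial>M) \<le> ennreal (R0 * sqrt (1 + s))" .
      qed
      finally show ?thesis .
    qed
    \<comment> \<open>The derivative of \<open>sqrt (1 + s)\<close> at 0 is 1/2, and concavity turns
      this into a bound for every positive \<open>s\<close>; \<open>R0\<close> cancels because it is
      also the integral of \<open>u\<close>.\<close>
    have diff: "(\<integral>\<^sup>+x. ennreal ((F s x - u x) / s) \<partial>M) \<le> ennreal (R0 / 2)" if s: "0 < s" for s
    proof -
      have F_nonneg: "AE x in M. 0 \<le> F s x"
        using AE_space by eventually_elim (use nonneg[OF v] s in \<open>auto simp: F_def\<close>)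
      have F_int: "integrable M (F s)"
        by (rule integrableI_nonneg) (use F_nonneg F_le[OF s] in \<open>auto simp: order_le_less_trans\<close>)
      have "ennreal (\<integral>x. F s x \<partial>M) \<le> ennreal (R0 * sqrt (1 + s))"
        using F_le[OF s] by (subst (asm) nn_integral_eq_integral[OF F_int F_nonneg])
      then have F_R0: "(\<integral>x. F s x \<partial>M) \<le> R0 * sqrt (1 + s)"
        using R0_nonneg s by (subst (asm) ennreal_le_iff) auto
      have F_ge: "AE x in M. 0 \<le> (F s x - u x) / s"
        using AE_space
      proof eventually_elim
        case (elim x)
        have "sqrt ((u x)\<^sup>2) \<le> F s x"
          unfolding F_def using nonneg[OF v elim] s by (intro real_sqrt_le_mono) auto
        then show ?case using u_nonneg[of x] s by simp
      qed
      have "(\<integral>\<^sup>+x. ennreal ((F s x - u x) / s) \<partial>M) = ennreal (\<integral>x. (F s x - u x) / s \<partial>M)"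
        by (rule nn_integral_eq_integral) (use F_int u_int F_ge in auto)
      also have "\<dots> = ennreal (((\<integral>x. F s x \<partial>M) - R0) / s)"
        using F_int u_int u_R0 by simp
      also have "\<dots> \<le> ennreal (R0 / 2)"
      proof (rule ennreal_leI)
        have "sqrt (1 + s) \<le> 1 + s / 2"
          using arith_geo_mean_sqrt[of 1 "1 + s"] s by simp
        then have "R0 * sqrt (1 + s) \<le> R0 * (1 + s / 2)"
          using R0_nonneg by (rule mult_left_mono)
        then show "((\<integral>x. F s x \<partial>M) - R0) / s \<le> R0 / 2"
          using F_R0 s by (simp add: field_simps)
      qed
      finally show ?thesis .
    qed
    define \<sigma> where "\<sigma> k = 1 / real (Suc k)" for k
    have \<sigma>: "0 < \<sigma> k" "\<sigma> \<longlonglongrightarrow> 0" for k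
      unfolding \<sigma>_def using LIMSEQ_inverse_real_of_nat by (auto simp: inverse_eq_divide)
    \<comment> \<open>The pointwise derivative of \<open>F\<close> at 0 is
      \<open>v / (2 * u)\<close>. Where \<open>u\<close> vanishes and \<open>v\<close> does not, the
      difference quotient grows like \<open>sqrt (Suc k)\<close>, matching the infinite quotient in
      \<open>ennreal\<close>; where both vanish it is 0, as is \<open>0 / 0\<close>. So the identity
      holds everywhere and Fatou needs no exceptional set.\<close>
    have quot: "liminf (\<lambda>k. ennreal ((F (\<sigma> k) x - u x) / \<sigma> k)) = ennreal (v x) / ennreal (u x) / 2"
      if x: "x \<in> space M" for x
    proof -
      have vx: "0 \<le> v x" by (rule nonneg[OF v x])
      have "(\<lambda>k. ennreal ((F (\<sigma> k) x - u x) / \<sigma> k)) \<longlonglongrightarrow> ennreal (v x) / ennreal (u x) / 2"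
      proof (cases "u x = 0")
        case False
        then have ux: "0 < u x" using u_nonneg[of x] by simp
        have "(\<lambda>k. F (\<sigma> k) x) \<longlonglongrightarrow> sqrt ((u x)\<^sup>2 + 0 * v x)"
          unfolding F_def by (intro tendsto_intros \<sigma>)
        then have "(\<lambda>k. F (\<sigma> k) x) \<longlonglongrightarrow> u x" using ux by simp
        then have "(\<lambda>k. v x / (F (\<sigma> k) x + u x)) \<longlonglongrightarrow> v x / (u x + u x)"
          using ux by (intro tendsto_intros) auto
        moreover have "v x / (F (\<sigma> k) x + u x) = (F (\<sigma> k) x - u x) / \<sigma> k" for k
        proof -
          have F2: "F (\<sigma> k) x * F (\<sigma> k) x = (u x)\<^sup>2 + \<sigma> k * v x" "0 \<le> F (\<sigma> k) x"
            unfolding F_def using vx \<sigma>(1)[of k] by auto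
          have "0 < F (\<sigma> k) x + u x" using F2 ux by simp
          then show ?thesis using F2 \<sigma>(1)[of k]
            by (simp add: field_simps power2_eq_square)
        qed
        ultimately have "(\<lambda>k. (F (\<sigma> k) x - u x) / \<sigma> k) \<longlonglongrightarrow> v x / u x / 2" by (simp add: mult.commute)
        then have "(\<lambda>k. ennreal ((F (\<sigma> k) x - u x) / \<sigma> k)) \<longlonglongrightarrow> ennreal (v x / u x / 2)"
          by (rule tendsto_ennrealI)
        also have "ennreal (v x / u x / 2) = ennreal (v x) / ennreal (u x) / 2"
          using vx ux by (simp add: divide_ennreal ennreal_divide_numeral)
        finally show ?thesis .
      next
        case True
        show ?thesis
        proof (cases "v x = 0")
          case True
          then show ?thesis using \<open>u x = 0\<close> by (simp add: F_def)
        next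
          case False
          have eq: "(F (\<sigma> k) x - u x) / \<sigma> k = sqrt (v x) * sqrt (real (Suc k))" for k
            using True by (simp add: F_def \<sigma>_def real_sqrt_divide real_sqrt_mult field_simps
              real_divide_square_eq del: of_nat_Suc)
          have "filterlim (\<lambda>k. sqrt (v x) * sqrt (real (Suc k))) at_top sequentially"
            using vx False
            by (intro filterlim_tendsto_pos_mult_at_top[OF tendsto_const]
                filterlim_compose[OF sqrt_at_top] filterlim_compose[OF filterlim_real_sequentially]
                filterlim_Suc) auto
          then have "(\<lambda>k. ennreal ((F (\<sigma> k) x - u x) / \<sigma> k)) \<longlonglongrightarrow> top"
            unfolding eq by (simp add: ennreal_tendsto_top_eq_at_top)
          then show ?thesis using True False vx by (simp add: ennreal_top_divide)
        qed
      qed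
      from lim_imp_Liminf[OF _ this] show ?thesis by simp
    qed
    have "(\<integral>\<^sup>+x. ennreal (v x) / ennreal (u x) / 2 \<partial>M) =
        (\<integral>\<^sup>+x. liminf (\<lambda>k. ennreal ((F (\<sigma> k) x - u x) / \<sigma> k)) \<partial>M)"
      by (rule nn_integral_cong) (simp add: quot)
    also have "\<dots> \<le> liminf (\<lambda>k. \<integral>\<^sup>+x. ennreal ((F (\<sigma> k) x - u x) / \<sigma> k) \<partial>M)"
      by (rule nn_integral_liminf) measurable
    also have "\<dots> \<le> ennreal (R0 / 2)"
      by (rule Liminf_le[OF sequentially_bot]) (auto intro!: always_eventually diff \<sigma>)
    finally have "(\<integral>\<^sup>+x. ennreal (v x) / ennreal (u x) \<partial>M) / 2 \<le> ennreal R0 / 2"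
      using R0_nonneg by (simp add: nn_integral_divide ennreal_divide_numeral)
    then show ?thesis by (simp add: divide_ennreal_def ennreal_mult_le_mult_iff mult.commute[of _ "inverse 2"])
  qed
  show thesis
  proof
    show "u \<in> borel_measurable M" "0 \<le> u x" for x by (auto simp: u_nonneg)
    show "(\<integral>\<^sup>+x. ennreal (u x) \<partial>M) \<le> ennreal R"
      using R0_le u_R0 nn_integral_eq_integral[OF u_int] u_nonneg by (simp add: ennreal_leI)
    show "(\<integral>\<^sup>+x. ennreal (v x) / ennreal (u x) \<partial>M) \<le> ennreal R" if "v \<in> V" for v
      using first_order[OF that] R0_le by (meson ennreal_leI order_trans)
  qed
qed

section \<open>Tests and likelihood ratios for independent observations\<close>

abbreviation iid :: "'a measure \<Rightarrow> nat \<Rightarrow> (nat \<Rightarrow> 'a) measure" where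
  "iid M n \<equiv> PiM {..<n} (\<lambda>_. M)"

lemma (in prob_space) product_sigma_finite_const: "product_sigma_finite (\<lambda>_. M)"
  by (simp add: product_sigma_finite_def sigma_finite_measure_axioms)

lemma (in prob_space) prob_space_iid: "prob_space (iid M n)"
  by (intro prob_space_PiM prob_space_axioms)

lemma (in prob_space) AE_iid:
  assumes "AE x in M. Q x"
  shows "AE x in iid M n. \<forall>i<n. Q (x i)"
proof -
  have "AE x in iid M n. \<forall>i\<in>{..<n}. Q (x i)"
    using assms by (intro AE_finite_allI AE_PiM_component prob_space_axioms) auto
  then show ?thesis by (auto elim: eventually_mono)
qed

lemma (in prob_space) nn_integral_iid_prod:
  assumes "f \<in> borel_measurable M"
  shows "(\<integral>\<^sup>+x. (\<Prod>i<n. f (x i)) \<partial>iid M n) = (\<integral>\<^sup>+x. f x \<partial>M) ^ n"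
  using product_sigma_finite.product_nn_integral_prod[OF product_sigma_finite_const, of "{..<n}" "\<lambda>_. f"] assms
  by simp

lemma space_iid_nth: "x \<in> space (iid M n) \<Longrightarrow> i < n \<Longrightarrow> x i \<in> space M"
  by (auto simp: space_PiM)

text \<open>Here \<^term>\<open>v\<close> is the density of the alternative relative to the null \<^term>\<open>M\<close>.\<close>
definition type_II_error :: "'a measure \<Rightarrow> nat \<Rightarrow> ('a \<Rightarrow> real) \<Rightarrow> (nat \<Rightarrow> 'a) set \<Rightarrow> ennreal" where
  "type_II_error M n v A =
    (\<integral>\<^sup>+x. ennreal (\<Prod>i<n. v (x i)) * indicator (space (iid M n) - A) x \<partial>iid M n)"

lemma type_II_error_antimono: "A \<subseteq> A' \<Longrightarrow> type_II_error M n v A' \<le> type_II_error M n v A"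
  unfolding type_II_error_def by (intro nn_integral_mono mult_left_mono) (auto simp: indicator_def)

text \<open>
  Rejecting when \<open>\<Prod>i<n. u (x i) > 1\<close>, with \<open>u\<close> from the Hellinger projection, tests the null
  against the whole convex class at once.
\<close>
lemma (in prob_space) convex_class_test:
  fixes V :: "('a \<Rightarrow> real) set"
  assumes ne: "V \<noteq> {}"
    and meas: "\<And>v. v \<in> V \<Longrightarrow> v \<in> borel_measurable M"
    and nonneg: "\<And>v x. v \<in> V \<Longrightarrow> x \<in> space M \<Longrightarrow> 0 \<le> v x"
    and mass: "\<And>v. v \<in> V \<Longrightarrow> (\<integral>\<^sup>+x. ennreal (v x) \<partial>M) \<le> 1"
    and conv: "\<And>v w t. v \<in> V \<Longrightarrow> w \<in> V \<Longrightarrow> 0 \<le> t \<Longrightarrow> t \<le> 1 \<Longrightarrow> (\<lambda>x. (1 - t) * v x + t * w x) \<in> V"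
    and R: "\<And>v. v \<in> V \<Longrightarrow> (\<integral>x. sqrt (v x) \<partial>M) \<le> R"
  obtains A where "A \<in> sets (iid M n)" "emeasure (iid M n) A \<le> ennreal R ^ n"
    "\<And>v. v \<in> V \<Longrightarrow> type_II_error M n v A \<le> ennreal R ^ n"
proof -
  obtain u where [measurable]: "u \<in> borel_measurable M" and u: "\<And>x. 0 \<le> u x"
      and u_R: "(\<integral>\<^sup>+x. ennreal (u x) \<partial>M) \<le> ennreal R"
      and vu_R: "\<And>v. v \<in> V \<Longrightarrow> (\<integral>\<^sup>+x. ennreal (v x) / ennreal (u x) \<partial>M) \<le> ennreal R"
  proof (rule hellinger_projection[of V R])
  qed (use assms in auto)
  \<comment> \<open>Markov's inequality bounds the first error by the integral of the product of the
    \<open>u (x i)\<close>. Outside \<open>A\<close> that product is at most 1, so the product of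
    the \<open>v (x i)\<close> is at most that of the quotients \<open>v / u\<close>, which bounds
    the second error.\<close>
  define A where "A = {x \<in> space (iid M n). 1 < (\<Prod>i<n. ennreal (u (x i)))}"
  have A[measurable]: "A \<in> sets (iid M n)" unfolding A_def by measurable
  show thesis
  proof
    show "A \<in> sets (iid M n)" by fact
    have "emeasure (iid M n) A = (\<integral>\<^sup>+x. indicator A x \<partial>iid M n)" by simp
    also have "\<dots> \<le> (\<integral>\<^sup>+x. (\<Prod>i<n. ennreal (u (x i))) \<partial>iid M n)"
      by (intro nn_integral_mono) (auto simp: A_def indicator_def)
    also have "\<dots> = (\<integral>\<^sup>+x. ennreal (u x) \<partial>M) ^ n"
      by (rule nn_integral_iid_prod) measurable
    also have "\<dots> \<le> ennreal R ^ n" by (intro power_mono u_R) auto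
    finally show "emeasure (iid M n) A \<le> ennreal R ^ n" .
    fix v assume v: "v \<in> V"
    note [measurable] = meas[OF v]
    let ?r = "\<lambda>x. ennreal (v x) / ennreal (u x)"
    \<comment> \<open>Cancelling \<open>u\<close> in \<open>v / u * u\<close> fails only where
      \<open>u = 0 < v\<close>, and there the quotient is infinite.\<close>
    have "AE x in M. ?r x \<noteq> \<infinity>"
      using vu_R[OF v] by (intro nn_integral_PInf_AE) (auto simp: top_unique)
    then have "AE x in M. ennreal (v x) = ?r x * ennreal (u x)"
    proof eventually_elim
      case (elim x)
      then show ?case using u[of x]
        by (cases "u x = 0") (auto simp: ennreal_top_divide ennreal_divide_times split: if_splits)
    qed
    then have "AE x in iid M n. \<forall>i<n. ennreal (v (x i)) = ?r (x i) * ennreal (u (x i))"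
      by (rule AE_iid)
    then have "AE x in iid M n. ennreal (\<Prod>i<n. v (x i)) * indicator (space (iid M n) - A) x \<le> (\<Prod>i<n. ?r (x i))"
      using AE_space
    proof eventually_elim
      case (elim x)
      have "ennreal (\<Prod>i<n. v (x i)) = (\<Prod>i<n. ennreal (v (x i)))"
        using nonneg[OF v space_iid_nth[OF elim(2)]] by (intro prod_ennreal[symmetric]) auto
      also have "\<dots> = (\<Prod>i<n. ?r (x i)) * (\<Prod>i<n. ennreal (u (x i)))"
        using elim(1) by (simp flip: prod.distrib)
      finally show ?case
        using elim(2) mult_left_mono[of "\<Prod>i<n. ennreal (u (x i))" 1 "\<Prod>i<n. ?r (x i)"]
        by (auto simp: A_def indicator_def not_less)
    qed
    then have "type_II_error M n v A \<le> (\<integral>\<^sup>+x. (\<Prod>i<n. ?r (x i)) \<partial>iid M n)"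
      unfolding type_II_error_def by (rule nn_integral_mono_AE)
    also have "\<dots> = (\<integral>\<^sup>+x. ?r x \<partial>M) ^ n"
      by (rule nn_integral_iid_prod) measurable
    also have "\<dots> \<le> ennreal R ^ n" by (intro power_mono vu_R v) auto
    finally show "type_II_error M n v A \<le> ennreal R ^ n" .
  qed
qed

section \<open>Second moments of independent sums and lower bounds for the evidence\<close>

lemma (in prob_space) iid_sum_second_moment:
  fixes z :: "'a \<Rightarrow> real"
  assumes z: "integrable M z" "integrable M (\<lambda>x. (z x)\<^sup>2)" "(\<integral>x. z x \<partial>M) = 0"
  shows "integrable (iid M n) (\<lambda>x. (\<Sum>i<n. z (x i))\<^sup>2)"
    and "(\<integral>x. (\<Sum>i<n. z (x i))\<^sup>2 \<partial>iid M n) = real n * (\<integral>x. (z x)\<^sup>2 \<partial>M)"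
proof -
  have pair: "integrable (iid M n) (\<lambda>x. z (x i) * z (x j)) \<and>
      (\<integral>x. z (x i) * z (x j) \<partial>iid M n) = (if i = j then \<integral>x. (z x)\<^sup>2 \<partial>M else 0)"
    if ij: "i < n" "j < n" for i j
  proof -
    \<comment> \<open>\<open>z (x i) * z (x j)\<close> is written as a product over all coordinates,
      with factor 1 away from \<open>i\<close> and \<open>j\<close>, so one product formula covers
      the diagonal terms and the vanishing off-diagonal ones.\<close>
    define f where "f k = (if k = i \<and> k = j then (\<lambda>x. (z x)\<^sup>2) else if k = i \<or> k = j then z else (\<lambda>_. 1))" for k
    have f_int: "integrable M (f k)" for k using z by (simp add: f_def)
    have "(\<Prod>k<n. f k (x k)) = (\<Prod>k\<in>{i, j}. f k (x k))" for x
      by (rule prod.mono_neutral_right) (use ij in \<open>auto simp: f_def\<close>)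
    then have eq: "(\<Prod>k<n. f k (x k)) = z (x i) * z (x j)" for x
      by (cases "i = j") (auto simp: f_def power2_eq_square)
    have "(\<Prod>k<n. \<integral>x. f k x \<partial>M) = (\<Prod>k\<in>{i, j}. \<integral>x. f k x \<partial>M)"
      by (rule prod.mono_neutral_right) (use ij in \<open>auto simp: f_def prob_space\<close>)
    then have "(\<Prod>k<n. \<integral>x. f k x \<partial>M) = (if i = j then \<integral>x. (z x)\<^sup>2 \<partial>M else 0)"
      using z by (auto simp: f_def)
    then show ?thesis
      using product_sigma_finite.product_integral_prod[OF product_sigma_finite_const, of "{..<n}" f]
        product_sigma_finite.product_integrable_prod[OF product_sigma_finite_const, of "{..<n}" f] f_int
      by (simp add: eq)
  qed
  have eq: "(\<Sum>i<n. z (x i))\<^sup>2 = (\<Sum>i<n. \<Sum>j<n. z (x i) * z (x j))" for x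
    by (simp add: power2_eq_square sum_product)
  show "integrable (iid M n) (\<lambda>x. (\<Sum>i<n. z (x i))\<^sup>2)"
    unfolding eq using pair by (intro Bochner_Integration.integrable_sum) auto
  have "(\<integral>x. (\<Sum>i<n. z (x i))\<^sup>2 \<partial>iid M n) = (\<Sum>i<n. \<Sum>j<n. \<integral>x. z (x i) * z (x j) \<partial>iid M n)"
    unfolding eq using pair
    by (subst Bochner_Integration.integral_sum Bochner_Integration.integrable_sum;
        (intro sum.cong refl Bochner_Integration.integral_sum Bochner_Integration.integrable_sum)?) auto
  also have "\<dots> = (\<Sum>i<n. \<integral>x. (z x)\<^sup>2 \<partial>M)"
    using pair by (intro sum.cong) (auto simp: sum.delta)
  finally show "(\<integral>x. (\<Sum>i<n. z (x i))\<^sup>2 \<partial>iid M n) = real n * (\<integral>x. (z x)\<^sup>2 \<partial>M)" by simp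
qed

text \<open>Chebyshev with \<open>a = real n * e\<^sup>2\<close>, which bounds both minus the mean
  of the sum and its variance. One \<open>a\<close> in the threshold pays for the mean; the second
  gives the bound \<open>a / (a + K)\<^sup>2 \<le> 1 / (a + K) \<le> 1 / K\<close>, uniform in
  \<open>n\<close> and \<open>e\<close>.\<close>

lemma (in prob_space) iid_sum_lower_deviation:
  fixes y :: "'a \<Rightarrow> real"
  assumes [measurable]: "y \<in> borel_measurable M"
    and mean: "- (\<integral>x. y x \<partial>M) \<le> e\<^sup>2"
    and second: "(\<integral>\<^sup>+x. ennreal ((y x)\<^sup>2) \<partial>M) \<le> ennreal (e\<^sup>2)"
    and K: "0 < K"
  shows "emeasure (iid M n) {x \<in> space (iid M n). (\<Sum>i<n. y (x i)) < - 2 * (real n * e\<^sup>2) - K} \<le> ennreal (1 / K)"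
proof -
  interpret S: prob_space "iid M n" by (rule prob_space_iid)
  have y2: "integrable M (\<lambda>x. (y x)\<^sup>2)"
    by (rule integrableI_nonneg) (use second in \<open>auto simp: order_le_less_trans\<close>)
  have y1: "integrable M y"
    by (rule square_integrable_imp_integrable) (use y2 in auto)
  define m where "m = (\<integral>x. y x \<partial>M)"
  define z where "z x = y x - m" for x
  have z: "integrable M z" "integrable M (\<lambda>x. (z x)\<^sup>2)" "(\<integral>x. z x \<partial>M) = 0"
    unfolding z_def using y1 y2 by (auto simp: power2_diff m_def prob_space)
  have "(\<integral>x. (z x)\<^sup>2 \<partial>M) = (\<integral>x. (y x)\<^sup>2 \<partial>M) - m\<^sup>2"
    unfolding z_def using variance_eq[OF y1 y2] by (simp add: m_def)
  also have "\<dots> \<le> e\<^sup>2"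
  proof -
    have "ennreal (\<integral>x. (y x)\<^sup>2 \<partial>M) \<le> ennreal (e\<^sup>2)"
      using second by (subst (asm) nn_integral_eq_integral[OF y2]) auto
    then have "(\<integral>x. (y x)\<^sup>2 \<partial>M) \<le> e\<^sup>2" by simp
    then show ?thesis using zero_le_power2[of m] by linarith
  qed
  finally have var: "(\<integral>x. (z x)\<^sup>2 \<partial>M) \<le> e\<^sup>2" .
  define a where "a = real n * e\<^sup>2"
  have a: "0 \<le> a" by (simp add: a_def)
  have meas[measurable]: "z \<in> borel_measurable M" unfolding z_def by measurable
  have "{x \<in> space (iid M n). (\<Sum>i<n. y (x i)) < - 2 * (real n * e\<^sup>2) - K}
      \<subseteq> {x \<in> space (iid M n). (\<Sum>i<n. z (x i))\<^sup>2 \<ge> (a + K)\<^sup>2}"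
  proof safe
    fix x assume x: "(\<Sum>i<n. y (x i)) < - 2 * (real n * e\<^sup>2) - K"
    have "- (real n * m) \<le> a"
      unfolding a_def using mult_left_mono[OF mean, of "real n"] by (simp add: m_def)
    then have "(\<Sum>i<n. z (x i)) < - (a + K)"
      using x by (simp add: z_def sum_subtractf a_def)
    then show "(a + K)\<^sup>2 \<le> (\<Sum>i<n. z (x i))\<^sup>2"
      using a K by (intro abs_le_square_iff[THEN iffD1]) auto
  qed
  then have "emeasure (iid M n) {x \<in> space (iid M n). (\<Sum>i<n. y (x i)) < - 2 * (real n * e\<^sup>2) - K}
      \<le> emeasure (iid M n) {x \<in> space (iid M n). (\<Sum>i<n. z (x i))\<^sup>2 \<ge> (a + K)\<^sup>2}"
    by (rule emeasure_mono) measurable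
  also have "\<dots> \<le> ennreal (1 / (a + K)\<^sup>2 * (\<integral>x. (\<Sum>i<n. z (x i))\<^sup>2 \<partial>iid M n))"
    by (rule integral_Markov_inequality) (use iid_sum_second_moment(1)[OF z] a K in auto)
  also have "\<dots> \<le> ennreal (1 / K)"
  proof (rule ennreal_leI)
    have "(\<integral>x. (\<Sum>i<n. z (x i))\<^sup>2 \<partial>iid M n) \<le> a"
      unfolding iid_sum_second_moment(2)[OF z] a_def by (intro mult_left_mono var) auto
    then have "1 / (a + K)\<^sup>2 * (\<integral>x. (\<Sum>i<n. z (x i))\<^sup>2 \<partial>iid M n) \<le> 1 / (a + K)\<^sup>2 * (a + K)"
      using K by (intro mult_left_mono) auto
    also have "\<dots> = 1 / (a + K)"
      by (simp add: power2_eq_square)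
    also have "\<dots> \<le> 1 / K"
      using a K by (intro divide_left_mono) auto
    finally show "1 / (a + K)\<^sup>2 * (\<integral>x. (\<Sum>i<n. z (x i))\<^sup>2 \<partial>iid M n) \<le> 1 / K" .
  qed
  finally show ?thesis .
qed

lemma borel_measurable_iid_prod:
  fixes v :: "'b \<Rightarrow> 'a \<Rightarrow> real"
  assumes joint: "(\<lambda>(x, p). v p x) \<in> borel_measurable (M \<Otimes>\<^sub>M Q)"
  shows "(\<lambda>(x, p). \<Prod>i<n. v p (x i)) \<in> borel_measurable (iid M n \<Otimes>\<^sub>M Q)"
proof -
  have "(\<lambda>z. v (snd z) (fst z i)) \<in> borel_measurable (iid M n \<Otimes>\<^sub>M Q)" if i: "i \<in> {..<n}" for i
  proof -
    have [measurable]: "(\<lambda>x. x i) \<in> measurable (iid M n) M"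
      using i by (rule measurable_component_singleton)
    have "(\<lambda>z. (fst z i, snd z)) \<in> measurable (iid M n \<Otimes>\<^sub>M Q) (M \<Otimes>\<^sub>M Q)"
      by measurable
    from measurable_compose[OF this joint] show ?thesis by simp
  qed
  then show ?thesis
    unfolding split_beta' by (rule borel_measurable_prod)
qed

text \<open>
  Chebyshev's inequality is applied for each parameter separately; Tonelli and Markov then show that,
  except on an event of small probability, at least half of the prior mass of \<^term>\<open>B\<close> has a large
  likelihood. The slack \<^term>\<open>K\<close> is a free constant because \<open>n e\<^sup>2\<close> need not tend to infinity.
\<close>
lemma (in prob_space) evidence_lower_bound:
  fixes v :: "'b \<Rightarrow> 'a \<Rightarrow> real"
  assumes Q: "prob_space Q"
    and joint: "(\<lambda>(x, p). v p x) \<in> borel_measurable (M \<Otimes>\<^sub>M Q)"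
    and B[measurable]: "B \<in> sets Q"
    and pos: "\<And>p. p \<in> B \<Longrightarrow> AE x in M. 0 < v p x"
    and mean: "\<And>p. p \<in> B \<Longrightarrow> - (\<integral>x. ln (v p x) \<partial>M) \<le> e\<^sup>2"
    and second: "\<And>p. p \<in> B \<Longrightarrow> (\<integral>\<^sup>+x. ennreal ((ln (v p x))\<^sup>2) \<partial>M) \<le> ennreal (e\<^sup>2)"
    and K: "0 < K"
  shows "emeasure (iid M n) {x \<in> space (iid M n). (\<integral>\<^sup>+p. ennreal (\<Prod>i<n. v p (x i)) \<partial>Q)
      < ennreal (exp (- 2 * (real n * e\<^sup>2) - K) / 2) * emeasure Q B} \<le> ennreal (2 / K)"
proof (cases "emeasure Q B = 0")
  case True
  then show ?thesis by simp
next
  case False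
  interpret S: prob_space "iid M n" by (rule prob_space_iid)
  interpret Q: prob_space Q by fact
  interpret SQ: pair_sigma_finite "iid M n" Q ..
  note joint_prod[measurable] = borel_measurable_iid_prod[OF joint, of n]
  define T where "T = exp (- 2 * (real n * e\<^sup>2) - K)"
  define \<beta> where "\<beta> = measure Q B"
  have \<beta>: "emeasure Q B = ennreal \<beta>" "0 < \<beta>"
    using False by (auto simp: \<beta>_def Q.emeasure_eq_measure zero_less_measure_iff)
  \<comment> \<open>\<open>h x\<close> marks the parameters in \<open>B\<close> whose likelihood
    ratio at \<open>x\<close> falls below \<open>T\<close>. Their mass has mean at most
    \<open>\<beta> / K\<close>, so Markov's inequality at level \<open>\<beta> / 2\<close> yields
    the final \<open>2 / K\<close>.\<close>
  define h :: "(nat \<Rightarrow> 'a) \<Rightarrow> 'b \<Rightarrow> ennreal" where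
    "h x p = indicator B p * indicator {..<T} (\<Prod>i<n. v p (x i))" for x p
  have h_meas: "case_prod h \<in> borel_measurable (iid M n \<Otimes>\<^sub>M Q)"
  proof -
    have "(\<lambda>z. indicator B (snd z) * indicator {..<T} ((\<lambda>(x, p). \<Prod>i<n. v p (x i)) z) :: ennreal)
        \<in> borel_measurable (iid M n \<Otimes>\<^sub>M Q)"
      by measurable
    then show ?thesis by (simp add: h_def split_beta')
  qed
  have v_meas: "v p \<in> borel_measurable M" if "p \<in> space Q" for p
    using measurable_compose[OF measurable_Pair2' joint, of p] that by simp
  have inner: "(\<integral>\<^sup>+x. h x p \<partial>iid M n) \<le> ennreal (1 / K) * indicator B p" if "p \<in> space Q" for p
  proof (cases "p \<in> B")
    case p: True
    note [measurable] = v_meas[OF that]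
    have "(\<integral>\<^sup>+x. h x p \<partial>iid M n) = (\<integral>\<^sup>+x. indicator {x \<in> space (iid M n). (\<Prod>i<n. v p (x i)) < T} x \<partial>iid M n)"
      using p by (intro nn_integral_cong) (auto simp: h_def indicator_def)
    also have "\<dots> = emeasure (iid M n) {x \<in> space (iid M n). (\<Prod>i<n. v p (x i)) < T}"
      by (rule nn_integral_indicator) measurable
    also have "\<dots> \<le> emeasure (iid M n) {x \<in> space (iid M n). (\<Sum>i<n. ln (v p (x i))) < - 2 * (real n * e\<^sup>2) - K}"
    proof (rule emeasure_mono_AE)
      show "AE x in iid M n. x \<in> {x \<in> space (iid M n). (\<Prod>i<n. v p (x i)) < T} \<longrightarrow>
          x \<in> {x \<in> space (iid M n). (\<Sum>i<n. ln (v p (x i))) < - 2 * (real n * e\<^sup>2) - K}"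
        using AE_iid[OF pos[OF p]]
      proof eventually_elim
        case (elim x)
        then have "(\<Prod>i<n. v p (x i)) = exp (\<Sum>i<n. ln (v p (x i)))"
          by (simp add: exp_sum)
        then show ?case by (simp add: T_def)
      qed
    qed measurable
    also have "\<dots> \<le> ennreal (1 / K)"
      by (rule iid_sum_lower_deviation) (use mean[OF p] second[OF p] K in auto)
    finally show ?thesis using p by simp
  qed (simp add: h_def)
  have "(\<integral>\<^sup>+x. (\<integral>\<^sup>+p. h x p \<partial>Q) \<partial>iid M n) = (\<integral>\<^sup>+p. (\<integral>\<^sup>+x. h x p \<partial>iid M n) \<partial>Q)"
    by (rule SQ.Fubini'[symmetric, OF h_meas])
  also have "\<dots> \<le> (\<integral>\<^sup>+p. ennreal (1 / K) * indicator B p \<partial>Q)"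
    by (intro nn_integral_mono inner)
  also have "\<dots> = ennreal (1 / K) * ennreal \<beta>"
    by (simp add: nn_integral_cmult_indicator \<beta>)
  finally have total: "(\<integral>\<^sup>+x. (\<integral>\<^sup>+p. h x p \<partial>Q) \<partial>iid M n) \<le> ennreal (1 / K) * ennreal \<beta>" .
  have H_meas[measurable]: "(\<lambda>x. \<integral>\<^sup>+p. h x p \<partial>Q) \<in> borel_measurable (iid M n)"
    using h_meas by (rule Q.borel_measurable_nn_integral)
  \<comment> \<open>If the unmarked part of \<open>B\<close> had mass at least
    \<open>\<beta> / 2\<close>, it alone would contribute \<open>T * \<beta> / 2\<close> to the
    integral; hence a small integral forces the marked part to have mass at least
    \<open>\<beta> / 2\<close>.\<close>
  have "{x \<in> space (iid M n). (\<integral>\<^sup>+p. ennreal (\<Prod>i<n. v p (x i)) \<partial>Q) < ennreal (T / 2) * emeasure Q B}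
      \<subseteq> {x \<in> space (iid M n). 1 \<le> ennreal (2 / \<beta>) * (\<integral>\<^sup>+p. h x p \<partial>Q)}"
  proof (intro subsetI, elim CollectE conjE, intro CollectI conjI)
    fix x assume x: "x \<in> space (iid M n)"
      and small: "(\<integral>\<^sup>+p. ennreal (\<Prod>i<n. v p (x i)) \<partial>Q) < ennreal (T / 2) * emeasure Q B"
    have [measurable]: "(\<lambda>p. \<Prod>i<n. v p (x i)) \<in> borel_measurable Q"
      using measurable_compose[OF measurable_Pair1'[OF x] joint_prod] by simp
    define D where "D = {p \<in> space Q. (\<Prod>i<n. v p (x i)) < T}"
    have [measurable]: "D \<in> sets Q" unfolding D_def by measurable
    have "(\<integral>\<^sup>+p. h x p \<partial>Q) = (\<integral>\<^sup>+p. indicator (B \<inter> D) p \<partial>Q)"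
      by (intro nn_integral_cong) (auto simp: h_def D_def indicator_def)
    also have "\<dots> = ennreal (measure Q (B \<inter> D))"
      by (simp add: Q.emeasure_eq_measure)
    finally have hD: "(\<integral>\<^sup>+p. h x p \<partial>Q) = ennreal (measure Q (B \<inter> D))" .
    have "ennreal (T * measure Q (B - D)) = (\<integral>\<^sup>+p. ennreal T * indicator (B - D) p \<partial>Q)"
      by (simp add: nn_integral_cmult_indicator Q.emeasure_eq_measure ennreal_mult T_def)
    also have "\<dots> \<le> (\<integral>\<^sup>+p. ennreal (\<Prod>i<n. v p (x i)) \<partial>Q)"
      by (intro nn_integral_mono) (auto simp: D_def indicator_def not_less intro!: ennreal_leI)
    also note small
    also have "ennreal (T / 2) * emeasure Q B = ennreal (T * (\<beta> / 2))"
      by (simp add: \<beta> ennreal_mult[symmetric] T_def less_imp_le)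
    finally have "measure Q (B - D) < \<beta> / 2"
      by (subst (asm) ennreal_less_iff) (auto simp: T_def)
    moreover have "measure Q (B - D) + measure Q (B \<inter> D) = \<beta>"
      unfolding \<beta>_def by (subst Q.finite_measure_Union[symmetric]) (auto intro!: arg_cong[where f="measure Q"])
    ultimately have "\<beta> / 2 \<le> measure Q (B \<inter> D)" by linarith
    then have "1 \<le> 2 / \<beta> * measure Q (B \<inter> D)"
      using \<beta>(2) by (simp add: field_simps)
    then show "1 \<le> ennreal (2 / \<beta>) * (\<integral>\<^sup>+p. h x p \<partial>Q)"
      unfolding hD using \<beta>(2) by (simp add: ennreal_mult[symmetric] del: times_divide_eq_left)
  qed
  then have "emeasure (iid M n) {x \<in> space (iid M n). (\<integral>\<^sup>+p. ennreal (\<Prod>i<n. v p (x i)) \<partial>Q) < ennreal (T / 2) * emeasure Q B}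
      \<le> emeasure (iid M n) {x \<in> space (iid M n). 1 \<le> ennreal (2 / \<beta>) * (\<integral>\<^sup>+p. h x p \<partial>Q)}"
    by (rule emeasure_mono) measurable
  also have "\<dots> \<le> ennreal (2 / \<beta>) * (\<integral>\<^sup>+x. (\<integral>\<^sup>+p. h x p \<partial>Q) * indicator (space (iid M n)) x \<partial>iid M n)"
    by (rule nn_integral_Markov_inequality) auto
  also have "\<dots> = ennreal (2 / \<beta>) * (\<integral>\<^sup>+x. (\<integral>\<^sup>+p. h x p \<partial>Q) \<partial>iid M n)"
    by (intro arg_cong2[where f="(*)"] nn_integral_cong) auto
  also have "\<dots> \<le> ennreal (2 / \<beta>) * (ennreal (1 / K) * ennreal \<beta>)"
    by (intro mult_left_mono total) auto
  also have "\<dots> = ennreal (2 / K)"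
    using \<beta>(2) K by (simp add: ennreal_mult[symmetric])
  finally show ?thesis by (simp add: T_def)
qed

text \<open>
  The set \<^term>\<open>C\<close> is the only set of parameters that must be measurable: the test bound is needed
  pointwise outside \<^term>\<open>C\<close>, so the covering balls behind the test need not be measurable.
\<close>
lemma (in prob_space) integrated_ratio_dominance:
  fixes v :: "'b \<Rightarrow> 'a \<Rightarrow> real"
  assumes Q: "prob_space Q"
    and joint: "(\<lambda>(x, p). v p x) \<in> borel_measurable (M \<Otimes>\<^sub>M Q)"
    and nonneg: "\<And>p x. p \<in> space Q \<Longrightarrow> x \<in> space M \<Longrightarrow> 0 \<le> v p x"
    and mass: "\<And>p. p \<in> space Q \<Longrightarrow> (\<integral>\<^sup>+x. ennreal (v p x) \<partial>M) \<le> 1"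
    and A[measurable]: "A \<in> sets (iid M n)" and C[measurable]: "C \<in> sets Q"
    and test: "\<And>p. p \<in> space Q \<Longrightarrow> p \<notin> C \<Longrightarrow> type_II_error M n (v p) A \<le> \<tau>"
    and W[measurable]: "W \<in> borel_measurable (iid M n)"
    and low: "emeasure (iid M n) {x \<in> space (iid M n). W x < ennreal \<theta>} \<le> \<delta>" and \<theta>: "0 < \<theta>"
  shows "emeasure (iid M n) {x \<in> space (iid M n). W x \<le> \<kappa> * (\<integral>\<^sup>+p. ennreal (\<Prod>i<n. v p (x i)) \<partial>Q)}
    \<le> emeasure (iid M n) A + \<delta> + \<kappa> * ennreal (1 / \<theta>) * (\<tau> + emeasure Q C)"
proof -
  interpret S: prob_space "iid M n" by (rule prob_space_iid)
  interpret Q: prob_space Q by fact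
  interpret SQ: pair_sigma_finite "iid M n" Q ..
  note joint_prod[measurable] = borel_measurable_iid_prod[OF joint, of n]
  define L where "L x = (\<integral>\<^sup>+p. ennreal (\<Prod>i<n. v p (x i)) \<partial>Q)" for x
  have L[measurable]: "L \<in> borel_measurable (iid M n)"
    unfolding L_def by (rule Q.borel_measurable_nn_integral)
      (use measurable_compose[OF joint_prod measurable_ennreal] in \<open>simp add: split_beta'\<close>)
  let ?h = "\<lambda>x p. ennreal (\<Prod>i<n. v p (x i)) * indicator (space (iid M n) - A) x"
  have h_meas: "case_prod ?h \<in> borel_measurable (iid M n \<Otimes>\<^sub>M Q)"
  proof -
    have "(\<lambda>z. ennreal ((\<lambda>(x, p). \<Prod>i<n. v p (x i)) z) * indicator (space (iid M n) - A) (fst z))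
        \<in> borel_measurable (iid M n \<Otimes>\<^sub>M Q)"
      by measurable
    then show ?thesis by (simp add: split_beta')
  qed
  \<comment> \<open>Inside \<open>C\<close> the test gives nothing and the total mass of the
    alternative, at most 1, is the bound; integrated over \<open>Q\<close> this becomes the term
    \<open>emeasure Q C\<close>.\<close>
  have inner: "(\<integral>\<^sup>+x. ?h x p \<partial>iid M n) \<le> \<tau> + indicator C p" if p: "p \<in> space Q" for p
  proof (cases "p \<in> C")
    case True
    have v: "v p \<in> borel_measurable M"
      using measurable_compose[OF measurable_Pair2' joint, of p] p by simp
    have "(\<integral>\<^sup>+x. ?h x p \<partial>iid M n) \<le> (\<integral>\<^sup>+x. (\<Prod>i<n. ennreal (v p (x i))) \<partial>iid M n)"
    proof (rule nn_integral_mono)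
      fix x assume "x \<in> space (iid M n)"
      then have "ennreal (\<Prod>i<n. v p (x i)) = (\<Prod>i<n. ennreal (v p (x i)))"
        using nonneg[OF p space_iid_nth] by (intro prod_ennreal[symmetric]) auto
      then show "?h x p \<le> (\<Prod>i<n. ennreal (v p (x i)))"
        by (simp add: indicator_def)
    qed
    also have "\<dots> = (\<integral>\<^sup>+x. ennreal (v p x) \<partial>M) ^ n"
      by (rule nn_integral_iid_prod) (use v in measurable)
    also have "\<dots> \<le> 1" using mass[OF p] by (simp add: power_le_one)
    finally show ?thesis using True by (simp add: add_increasing)
  qed (use test[OF p] in \<open>simp add: type_II_error_def\<close>)
  have "(\<integral>\<^sup>+x. L x * indicator (space (iid M n) - A) x \<partial>iid M n) = (\<integral>\<^sup>+x. (\<integral>\<^sup>+p. ?h x p \<partial>Q) \<partial>iid M n)"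
  proof (rule nn_integral_cong)
    fix x assume x: "x \<in> space (iid M n)"
    have "(\<lambda>p. \<Prod>i<n. v p (x i)) \<in> borel_measurable Q"
      using measurable_compose[OF measurable_Pair1'[OF x] joint_prod] by simp
    then show "L x * indicator (space (iid M n) - A) x = (\<integral>\<^sup>+p. ?h x p \<partial>Q)"
      unfolding L_def by (subst nn_integral_multc) auto
  qed
  also have "\<dots> = (\<integral>\<^sup>+p. (\<integral>\<^sup>+x. ?h x p \<partial>iid M n) \<partial>Q)"
    by (rule SQ.Fubini'[symmetric, OF h_meas])
  also have "\<dots> \<le> (\<integral>\<^sup>+p. \<tau> + indicator C p \<partial>Q)"
    by (intro nn_integral_mono inner)
  also have "\<dots> = \<tau> + emeasure Q C"
    by (subst nn_integral_add) (auto simp: Q.emeasure_space_1)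
  finally have total: "(\<integral>\<^sup>+x. L x * indicator (space (iid M n) - A) x \<partial>iid M n) \<le> \<tau> + emeasure Q C" .
  let ?E1 = "{x \<in> space (iid M n). W x < ennreal \<theta>}"
  let ?E2 = "{x \<in> space (iid M n) - A. 1 \<le> \<kappa> * ennreal (1 / \<theta>) * L x}"
  \<comment> \<open>Three ways to fail: the test rejects, \<open>W\<close> is below
    \<open>\<theta>\<close>, or the integrated ratio is large although the test accepts. The last
    has small probability by Markov's inequality and \<open>total\<close>.\<close>
  have "{x \<in> space (iid M n). W x \<le> \<kappa> * L x} \<subseteq> (A \<union> ?E1) \<union> ?E2"
  proof (intro subsetI, elim CollectE conjE)
    fix x assume x: "x \<in> space (iid M n)" and le: "W x \<le> \<kappa> * L x"
    show "x \<in> (A \<union> ?E1) \<union> ?E2"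
    proof (cases "x \<in> A \<or> W x < ennreal \<theta>")
      case False
      then have "ennreal \<theta> \<le> \<kappa> * L x" using le by (auto simp: not_less intro: order_trans)
      then have "ennreal (1 / \<theta>) * ennreal \<theta> \<le> ennreal (1 / \<theta>) * (\<kappa> * L x)"
        by (rule mult_left_mono) simp
      then have "1 \<le> \<kappa> * ennreal (1 / \<theta>) * L x"
        using \<theta> by (simp add: ennreal_mult[symmetric] ac_simps)
      then show ?thesis using False x by auto
    qed (use x in auto)
  qed
  then have "emeasure (iid M n) {x \<in> space (iid M n). W x \<le> \<kappa> * L x} \<le> emeasure (iid M n) ((A \<union> ?E1) \<union> ?E2)"
    by (rule emeasure_mono) measurable
  also have "\<dots> \<le> emeasure (iid M n) (A \<union> ?E1) + emeasure (iid M n) ?E2"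
    by (rule emeasure_subadditive) measurable
  also have "\<dots> \<le> (emeasure (iid M n) A + emeasure (iid M n) ?E1) + emeasure (iid M n) ?E2"
    by (intro add_mono emeasure_subadditive) auto
  also have "emeasure (iid M n) ?E2 \<le> \<kappa> * ennreal (1 / \<theta>) * (\<integral>\<^sup>+x. L x * indicator (space (iid M n) - A) x \<partial>iid M n)"
    by (rule nn_integral_Markov_inequality) auto
  also have "\<dots> \<le> \<kappa> * ennreal (1 / \<theta>) * (\<tau> + emeasure Q C)"
    by (intro mult_left_mono total) auto
  finally show ?thesis
    using low unfolding L_def by (auto intro: order_trans add_mono)
qed

section \<open>Tests for models with bounded entropy\<close>

lemma prob_densitiesD:
  assumes "p \<in> prob_densities \<mu>"
  shows "p \<in> borel_measurable \<mu>" "\<And>x. x \<in> space \<mu> \<Longrightarrow> 0 \<le> p x" "(\<integral>\<^sup>+x. ennreal (p x) \<partial>\<mu>) = 1"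
    "integrable \<mu> p" "(\<integral>x. p x \<partial>\<mu>) = 1"
proof -
  show m: "p \<in> borel_measurable \<mu>" and nn: "\<And>x. x \<in> space \<mu> \<Longrightarrow> 0 \<le> p x"
    and i: "(\<integral>\<^sup>+x. ennreal (p x) \<partial>\<mu>) = 1"
    using assms by (auto simp: prob_densities_def)
  have AE: "AE x in \<mu>. 0 \<le> p x" using AE_space by eventually_elim (rule nn)
  show "integrable \<mu> p" by (rule integrableI_nonneg) (use m i AE in auto)
  show "(\<integral>x. p x \<partial>\<mu>) = 1" using integral_eq_nn_integral[OF m AE] i by simp
qed

lemma prob_densities_mix:
  assumes p: "p \<in> prob_densities \<mu>" and q: "q \<in> prob_densities \<mu>" and t: "0 \<le> t" "t \<le> 1"
  shows "(\<lambda>x. (1 - t) * p x + t * q x) \<in> prob_densities \<mu>"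
proof -
  note P = prob_densitiesD[OF p] and Q = prob_densitiesD[OF q]
  note [measurable] = P(1) Q(1)
  have "(\<integral>\<^sup>+x. ennreal ((1 - t) * p x + t * q x) \<partial>\<mu>) = ennreal (\<integral>x. (1 - t) * p x + t * q x \<partial>\<mu>)"
    by (rule nn_integral_eq_integral) (use P Q t in auto)
  also have "(\<integral>x. (1 - t) * p x + t * q x \<partial>\<mu>) = 1"
    using P Q by simp
  finally show ?thesis
    using P(2) Q(2) t by (auto simp: prob_densities_def)
qed

lemma prob_space_density_prob_densities:
  "p0 \<in> prob_densities \<mu> \<Longrightarrow> prob_space (density \<mu> p0)"
  by (rule prob_spaceI) (auto simp: emeasure_density prob_densitiesD cong: nn_integral_cong_simp)

lemma AE_density_pos:
  assumes "p0 \<in> prob_densities \<mu>"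
  shows "AE x in density \<mu> p0. 0 < p0 x"
  using prob_densitiesD(1)[OF assms] by (subst AE_density) auto

text \<open>Only an inequality: mass that \<open>p\<close> puts where \<open>p0\<close> vanishes is
  invisible under the null. This is why the abstract lemmas ask for mass at most 1 rather than
  probability densities.\<close>

lemma nn_integral_likelihood_ratio_le_1:
  assumes p0: "p0 \<in> prob_densities \<mu>" and p: "p \<in> prob_densities \<mu>"
  shows "(\<integral>\<^sup>+x. ennreal (p x / p0 x) \<partial>density \<mu> p0) \<le> 1"
proof -
  note P = prob_densitiesD[OF p] and Q = prob_densitiesD[OF p0]
  note [measurable] = P(1) Q(1)
  have "(\<integral>\<^sup>+x. ennreal (p x / p0 x) \<partial>density \<mu> p0) = (\<integral>\<^sup>+x. ennreal (p0 x) * ennreal (p x / p0 x) \<partial>\<mu>)"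
    by (rule nn_integral_density) measurable
  also have "\<dots> \<le> (\<integral>\<^sup>+x. ennreal (p x) \<partial>\<mu>)"
    using P(2) Q(2) by (intro nn_integral_mono) (auto simp: ennreal_mult'[symmetric])
  finally show ?thesis by (simp add: P(3))
qed

text \<open>The left side is the Hellinger affinity of \<open>p0\<close> and \<open>p\<close>.
  Nothing is lost where \<open>p0\<close> vanishes, since the geometric mean
  \<open>sqrt (p0 * p)\<close> vanishes there too; expanding the square then gives an exact
  identity.\<close>

lemma integral_sqrt_likelihood_ratio:
  assumes p0: "p0 \<in> prob_densities \<mu>" and p: "p \<in> prob_densities \<mu>"
  shows "(\<integral>x. sqrt (p x / p0 x) \<partial>density \<mu> p0) = 1 - (hellinger \<mu> p0 p)\<^sup>2 / 2"
proof -
  note P = prob_densitiesD[OF p] and Q = prob_densitiesD[OF p0]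
  note [measurable] = P(1) Q(1)
  have "(\<integral>x. sqrt (p x / p0 x) \<partial>density \<mu> p0) = (\<integral>x. p0 x * sqrt (p x / p0 x) \<partial>\<mu>)"
    using Q(2) by (subst integral_density) auto
  also have "\<dots> = (\<integral>x. sqrt (p0 x * p x) \<partial>\<mu>)"
  proof (rule Bochner_Integration.integral_cong[OF refl])
    fix x assume x: "x \<in> space \<mu>"
    show "p0 x * sqrt (p x / p0 x) = sqrt (p0 x * p x)"
    proof (cases "p0 x = 0")
      case False
      then have "p0 x * sqrt (p x / p0 x) = sqrt ((p0 x)\<^sup>2) * sqrt (p x / p0 x)"
        using Q(2)[OF x] by simp
      also have "\<dots> = sqrt (p0 x * p x)"
        using False unfolding real_sqrt_mult[symmetric] by (simp add: power2_eq_square)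
      finally show ?thesis .
    qed simp
  qed
  finally have affinity: "(\<integral>x. sqrt (p x / p0 x) \<partial>density \<mu> p0) = (\<integral>x. sqrt (p0 x * p x) \<partial>\<mu>)" .
  have int: "integrable \<mu> (\<lambda>x. sqrt (p0 x * p x))"
  proof (rule Bochner_Integration.integrable_bound)
    show "integrable \<mu> (\<lambda>x. (p0 x + p x) / 2)" using P(4) Q(4) by simp
    show "AE x in \<mu>. norm (sqrt (p0 x * p x)) \<le> norm ((p0 x + p x) / 2)"
      using AE_space by eventually_elim (use arith_geo_mean_sqrt P(2) Q(2) in auto)
  qed measurable
  have "(\<integral>x. (sqrt (p0 x) - sqrt (p x))\<^sup>2 \<partial>\<mu>) = (\<integral>x. p0 x + p x - 2 * sqrt (p0 x * p x) \<partial>\<mu>)"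
    using P(2) Q(2) by (intro Bochner_Integration.integral_cong) (auto simp: power2_diff real_sqrt_mult)
  also have "\<dots> = 2 - 2 * (\<integral>x. sqrt (p0 x * p x) \<partial>\<mu>)"
    using P(4,5) Q(4,5) int by simp
  finally have "(\<integral>x. (sqrt (p0 x) - sqrt (p x))\<^sup>2 \<partial>\<mu>) = 2 - 2 * (\<integral>x. sqrt (p0 x * p x) \<partial>\<mu>)" .
  moreover have "(hellinger \<mu> p0 p)\<^sup>2 = (\<integral>x. (sqrt (p0 x) - sqrt (p x))\<^sup>2 \<partial>\<mu>)"
    unfolding hellinger_def by (simp add: Bochner_Integration.integral_nonneg)
  ultimately show ?thesis unfolding affinity by argo
qed

section \<open>From covers to tests: balls, shells, a whole model\<close>

lemma density_metricD:
  assumes "density_metric \<mu> d" "p \<in> prob_densities \<mu>" "q \<in> prob_densities \<mu>"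
  shows "0 \<le> d p q" "d p q = d q p" "\<And>r. r \<in> prob_densities \<mu> \<Longrightarrow> d p r \<le> d p q + d q r"
  using assms unfolding density_metric_def by blast+

text \<open>A bound below infinity excludes the empty infimum, and an infimum of a nonempty set in
  \<open>enat\<close> is attained, so an optimal cover exists. Cardinality 0, with logarithm minus
  infinity, is harmless since \<open>0 \<le> exp a\<close>.\<close>

lemma finite_cover_of_ln_covering_number:
  assumes "ln_enat (covering_number \<epsilon> S d) \<le> ereal a"
  obtains F where "finite F" "F \<subseteq> S" "S \<subseteq> (\<Union>c\<in>F. {p \<in> S. d c p < \<epsilon>})" "real (card F) \<le> exp a"
proof -
  define G where "G = {F. finite F \<and> F \<subseteq> S \<and> S \<subseteq> (\<Union>c\<in>F. {p \<in> S. d c p < \<epsilon>})}"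
  have cov: "covering_number \<epsilon> S d = Inf ((\<lambda>F. enat (card F)) ` G)"
    by (simp add: covering_number_def G_def)
  have ne: "G \<noteq> {}"
  proof
    assume "G = {}"
    then have "covering_number \<epsilon> S d = \<infinity>" unfolding cov by (simp add: top_enat_def)
    then show False using assms by (simp add: ln_enat_def)
  qed
  then have "Inf ((\<lambda>F. enat (card F)) ` G) \<in> (\<lambda>F. enat (card F)) ` G"
    unfolding Inf_enat_def by (auto intro: LeastI)
  then obtain F where F: "F \<in> G" "covering_number \<epsilon> S d = enat (card F)"
    unfolding cov by auto
  have "real (card F) \<le> exp a"
  proof (cases "card F = 0")
    case False
    then have "ln (real (card F)) \<le> a" using assms F(2) by (simp add: ln_enat_def)
    then show ?thesis using False by (metis exp_le_cancel_iff exp_ln of_nat_0_less_iff neq0_conv)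
  qed simp
  with F(1) show thesis by (auto simp: G_def intro: that)
qed

text \<open>By the triangle inequality every density in the ball keeps distance \<open>r\<close>
  from \<open>p0\<close>; \<open>d \<le> hellinger\<close> then makes its affinity with
  \<open>p0\<close> at most \<open>1 - r\<^sup>2 / 2\<close>, hence at most
  \<open>exp (- (r\<^sup>2 / 2))\<close>.\<close>

lemma ball_test:
  assumes p0: "p0 \<in> prob_densities \<mu>" and d: "density_metric \<mu> d"
    and hell: "\<And>p q. p \<in> prob_densities \<mu> \<Longrightarrow> q \<in> prob_densities \<mu> \<Longrightarrow> d p q \<le> hellinger \<mu> p q"
    and balls: "convex_balls \<mu> d"
    and c: "c \<in> prob_densities \<mu>" and r: "0 < r" and far: "2 * r \<le> d p0 c"
  obtains A where "A \<in> sets (iid (density \<mu> p0) n)"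
    "emeasure (iid (density \<mu> p0) n) A \<le> ennreal (exp (- (real n * r\<^sup>2 / 2)))"
    "\<And>p. p \<in> prob_densities \<mu> \<Longrightarrow> d c p < r \<Longrightarrow>
      type_II_error (density \<mu> p0) n (\<lambda>x. p x / p0 x) A
        \<le> ennreal (exp (- (real n * r\<^sup>2 / 2)))"
proof -
  interpret prob_space "density \<mu> p0" by (rule prob_space_density_prob_densities[OF p0])
  \<comment> \<open>The ball is taken among all densities, not within a model: only then is it
    convex.\<close>
  define U where "U = {p \<in> prob_densities \<mu>. d c p < r}"
  define V where "V = (\<lambda>p x. p x / p0 x) ` U"
  have U: "p \<in> prob_densities \<mu>" if "p \<in> U" for p using that by (simp add: U_def)
  have "d c c = 0" using d c by (simp add: density_metric_def)
  then have "V \<noteq> {}" using c r by (auto simp: V_def U_def)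
  moreover have "v \<in> borel_measurable (density \<mu> p0)" if "v \<in> V" for v
    using that prob_densitiesD(1)[OF U] prob_densitiesD(1)[OF p0] by (auto simp: V_def)
  moreover have "0 \<le> v x" if "v \<in> V" "x \<in> space (density \<mu> p0)" for v x
    using that prob_densitiesD(2)[OF U] prob_densitiesD(2)[OF p0] by (auto simp: V_def)
  moreover have "(\<integral>\<^sup>+x. ennreal (v x) \<partial>density \<mu> p0) \<le> 1" if "v \<in> V" for v
    using that nn_integral_likelihood_ratio_le_1[OF p0 U] by (auto simp: V_def)
  moreover have "(\<lambda>x. (1 - t) * v x + t * w x) \<in> V" if vw: "v \<in> V" "w \<in> V" and t: "0 \<le> t" "t \<le> 1" for v w t
  proof -
    obtain p q where pq: "p \<in> U" "q \<in> U" "v = (\<lambda>x. p x / p0 x)" "w = (\<lambda>x. q x / p0 x)"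
      using vw by (auto simp: V_def)
    have "d c (\<lambda>x. (1 - t) * p x + t * q x) < r"
      using balls c r pq(1,2) t unfolding convex_balls_def U_def by auto
    then have "(\<lambda>x. (1 - t) * p x + t * q x) \<in> U"
      using prob_densities_mix[OF U[OF pq(1)] U[OF pq(2)] t] by (simp add: U_def)
    then show ?thesis
      unfolding V_def by (rule rev_image_eqI) (simp add: pq add_divide_distrib)
  qed
  moreover have "(\<integral>x. sqrt (v x) \<partial>density \<mu> p0) \<le> exp (- (r\<^sup>2 / 2))" if v: "v \<in> V" for v
  proof -
    obtain p where p: "p \<in> U" "v = (\<lambda>x. p x / p0 x)" using v by (auto simp: V_def)
    have "d p0 c \<le> d p0 p + d p c" by (rule density_metricD(3)[OF d p0 U[OF p(1)] c])
    also have "d p c = d c p" by (rule density_metricD(2)[OF d U[OF p(1)] c])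
    also have "d c p < r" using p(1) by (simp add: U_def)
    finally have "r \<le> d p0 p" using far by simp
    also have "d p0 p \<le> hellinger \<mu> p0 p" by (rule hell[OF p0 U[OF p(1)]])
    finally have "r\<^sup>2 \<le> (hellinger \<mu> p0 p)\<^sup>2" using r by (intro power_mono) auto
    then have "(\<integral>x. sqrt (v x) \<partial>density \<mu> p0) \<le> 1 + - (r\<^sup>2 / 2)"
      using integral_sqrt_likelihood_ratio[OF p0 U[OF p(1)]] p(2) by simp
    also have "\<dots> \<le> exp (- (r\<^sup>2 / 2))" by (rule exp_ge_add_one_self)
    finally show ?thesis .
  qed
  ultimately show thesis
  proof (rule convex_class_test[of V "exp (- (r\<^sup>2 / 2))" n])
    fix A
    assume A: "A \<in> sets (iid (density \<mu> p0) n)"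
      "emeasure (iid (density \<mu> p0) n) A \<le> ennreal (exp (- (r\<^sup>2 / 2))) ^ n"
      "\<And>v. v \<in> V \<Longrightarrow> type_II_error (density \<mu> p0) n v A \<le> ennreal (exp (- (r\<^sup>2 / 2))) ^ n"
    have eq: "ennreal (exp (- (r\<^sup>2 / 2))) ^ n = ennreal (exp (- (real n * r\<^sup>2 / 2)))"
      by (simp add: ennreal_power flip: exp_of_nat_mult)
    show thesis
    proof (rule that)
      show "A \<in> sets (iid (density \<mu> p0) n)" by fact
      show "emeasure (iid (density \<mu> p0) n) A \<le> ennreal (exp (- (real n * r\<^sup>2 / 2)))"
        using A(2) unfolding eq .
      fix p assume "p \<in> prob_densities \<mu>" "d c p < r"
      then have "(\<lambda>x. p x / p0 x) \<in> V" by (simp add: V_def U_def)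
      from A(3)[OF this] show "type_II_error (density \<mu> p0) n (\<lambda>x. p x / p0 x) A \<le> ennreal (exp (- (real n * r\<^sup>2 / 2)))"
        unfolding eq .
    qed
  qed
qed

text \<open>Covering radius \<open>\<epsilon> / 3\<close> is what makes \<open>ball_test\<close>
  apply: a centre within \<open>\<epsilon> / 3\<close> of a shell point is at least
  \<open>2 * (\<epsilon> / 3)\<close> from \<open>p0\<close>. The constant 18 is
  \<open>2 * 3\<^sup>2\<close>. Rejecting when any ball test rejects multiplies the first error by
  at most the number of balls and does not raise the second.\<close>

lemma shell_test:
  assumes p0: "p0 \<in> prob_densities \<mu>" and d: "density_metric \<mu> d"
    and hell: "\<And>p q. p \<in> prob_densities \<mu> \<Longrightarrow> q \<in> prob_densities \<mu> \<Longrightarrow> d p q \<le> hellinger \<mu> p q"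
    and balls: "convex_balls \<mu> d"
    and S: "S \<subseteq> prob_densities \<mu>" and \<epsilon>: "0 < \<epsilon>"
    and entropy: "ln_enat (covering_number (\<epsilon> / 3) (metric_nbhd d p0 S (2 * \<epsilon>)) d) \<le> ereal a"
  obtains A where "A \<in> sets (iid (density \<mu> p0) n)"
    "emeasure (iid (density \<mu> p0) n) A \<le> ennreal (exp a * exp (- (real n * \<epsilon>\<^sup>2 / 18)))"
    "\<And>p. p \<in> S \<Longrightarrow> \<epsilon> \<le> d p p0 \<Longrightarrow> d p p0 \<le> 2 * \<epsilon> \<Longrightarrow>
      type_II_error (density \<mu> p0) n (\<lambda>x. p x / p0 x) A
        \<le> ennreal (exp (- (real n * \<epsilon>\<^sup>2 / 18)))"
proof -
  let ?S = "metric_nbhd d p0 S (2 * \<epsilon>)" and ?M = "iid (density \<mu> p0) n" and ?e = "exp (- (real n * \<epsilon>\<^sup>2 / 18))"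
  obtain F where F: "finite F" "F \<subseteq> ?S" "?S \<subseteq> (\<Union>c\<in>F. {p \<in> ?S. d c p < \<epsilon> / 3})" "real (card F) \<le> exp a"
    using finite_cover_of_ln_covering_number[OF entropy] .
  have F_dens: "c \<in> prob_densities \<mu>" if "c \<in> F" for c
    using that F(2) S by (auto simp: metric_nbhd_def)
  \<comment> \<open>Centres too close to \<open>p0\<close> cannot cover a point of the shell, so
    they receive the empty test.\<close>
  have ex: "\<exists>A. A \<in> sets ?M \<and> emeasure ?M A \<le> ennreal ?e \<and>
      (2 * (\<epsilon> / 3) \<le> d p0 c \<longrightarrow> (\<forall>p\<in>prob_densities \<mu>. d c p < \<epsilon> / 3 \<longrightarrow>
        type_II_error (density \<mu> p0) n (\<lambda>x. p x / p0 x) A \<le> ennreal ?e))" (is "\<exists>A. ?Q c A")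
    if c: "c \<in> F" for c
  proof (cases "2 * (\<epsilon> / 3) \<le> d p0 c")
    case True
    have eq: "real n * (\<epsilon> / 3)\<^sup>2 / 2 = real n * \<epsilon>\<^sup>2 / 18" by (simp add: power_divide)
    show ?thesis
    proof (rule ball_test[of p0 \<mu> d c "\<epsilon> / 3" n])
      fix A assume "A \<in> sets ?M" "emeasure ?M A \<le> ennreal (exp (- (real n * (\<epsilon> / 3)\<^sup>2 / 2)))"
        "\<And>p. p \<in> prob_densities \<mu> \<Longrightarrow> d c p < \<epsilon> / 3 \<Longrightarrow>
          type_II_error (density \<mu> p0) n (\<lambda>x. p x / p0 x) A \<le> ennreal (exp (- (real n * (\<epsilon> / 3)\<^sup>2 / 2)))"
      then show ?thesis unfolding eq by blast
    qed (use p0 d hell balls F_dens[OF c] True \<epsilon> in auto)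
  next
    case False
    then show ?thesis by (intro exI[of _ "{}"]) auto
  qed
  have "\<forall>c\<in>F. \<exists>A. ?Q c A" using ex by (intro ballI)
  from bchoice[OF this] obtain T where T: "\<And>c. c \<in> F \<Longrightarrow> T c \<in> sets ?M" "\<And>c. c \<in> F \<Longrightarrow> emeasure ?M (T c) \<le> ennreal ?e"
    "\<And>c p. c \<in> F \<Longrightarrow> 2 * (\<epsilon> / 3) \<le> d p0 c \<Longrightarrow> p \<in> prob_densities \<mu> \<Longrightarrow> d c p < \<epsilon> / 3 \<Longrightarrow>
        type_II_error (density \<mu> p0) n (\<lambda>x. p x / p0 x) (T c) \<le> ennreal ?e"
    by blast
  show thesis
  proof (rule that[of "\<Union>c\<in>F. T c"])
    show "(\<Union>c\<in>F. T c) \<in> sets ?M" using T(1) F(1) by auto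
    have "emeasure ?M (\<Union>c\<in>F. T c) \<le> (\<Sum>c\<in>F. emeasure ?M (T c))"
      by (rule emeasure_subadditive_finite) (use T(1) F(1) in auto)
    also have "\<dots> \<le> (\<Sum>c\<in>F. ennreal ?e)" by (intro sum_mono T(2))
    also have "\<dots> = ennreal (real (card F) * ?e)" by (simp add: ennreal_mult flip: ennreal_of_nat_eq_real_of_nat)
    also have "\<dots> \<le> ennreal (exp a * ?e)" by (intro ennreal_leI mult_right_mono F(4)) auto
    finally show "emeasure ?M (\<Union>c\<in>F. T c) \<le> ennreal (exp a * ?e)" .
    fix p assume p: "p \<in> S" "\<epsilon> \<le> d p p0" "d p p0 \<le> 2 * \<epsilon>"
    then obtain c where c: "c \<in> F" "d c p < \<epsilon> / 3" using F(3) by (auto simp: metric_nbhd_def)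
    have pd: "p \<in> prob_densities \<mu>" using p(1) S by auto
    have "d p p0 \<le> d p c + d c p0" by (rule density_metricD(3)[OF d pd F_dens[OF c(1)] p0])
    also have "d p c = d c p" by (rule density_metricD(2)[OF d pd F_dens[OF c(1)]])
    also have "d c p0 = d p0 c" by (rule density_metricD(2)[OF d F_dens[OF c(1)] p0])
    finally have far: "2 * (\<epsilon> / 3) \<le> d p0 c" using p(2) c(2) by simp
    have "type_II_error (density \<mu> p0) n (\<lambda>x. p x / p0 x) (\<Union>c\<in>F. T c)
        \<le> type_II_error (density \<mu> p0) n (\<lambda>x. p x / p0 x) (T c)"
      using c(1) by (intro type_II_error_antimono) auto
    also have "\<dots> \<le> ennreal ?e" by (rule T(3)[OF c(1) far pd c(2)])
    finally show "type_II_error (density \<mu> p0) n (\<lambda>x. p x / p0 x) (\<Union>c\<in>F. T c) \<le> ennreal ?e" .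
  qed
qed

lemma dyadic_shell:
  fixes t \<delta> :: real
  assumes "0 < \<delta>" "\<delta> \<le> t"
  obtains j :: nat where "2 ^ j * \<delta> \<le> t" "t \<le> 2 * (2 ^ j * \<delta>)"
proof -
  obtain k where "t / \<delta> < 2 ^ k" using real_arch_pow[of 2 "t / \<delta>"] by auto
  then have ex: "\<exists>j. t < 2 * (2 ^ j * \<delta>)"
    using assms by (intro exI[of _ k]) (auto simp: field_simps)
  define j where "j = (LEAST j. t < 2 * (2 ^ j * \<delta>))"
  have lt: "t < 2 * (2 ^ j * \<delta>)" unfolding j_def using ex by (rule LeastI_ex)
  have "2 ^ j * \<delta> \<le> t"
  proof (cases j)
    case (Suc i)
    then have "\<not> t < 2 * (2 ^ i * \<delta>)" unfolding j_def by (intro not_less_Least) simp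
    then show ?thesis using Suc by (simp add: field_simps)
  qed (use assms in simp)
  with lt show thesis by (intro that[of j]) auto
qed

text \<open>Because the entropy bound is uniform over all
  \<open>\<epsilon> \<ge> \<epsilon>\<^sub>0\<close>, the same \<open>a\<close> serves every dyadic
  shell, while the exponent of the \<open>j\<close>-th shell is \<open>b * 4 ^ j\<close>. Thus the
  first errors are summable over infinitely many shells.\<close>

lemma model_test:
  assumes p0: "p0 \<in> prob_densities \<mu>" and d: "density_metric \<mu> d"
    and hell: "\<And>p q. p \<in> prob_densities \<mu> \<Longrightarrow> q \<in> prob_densities \<mu> \<Longrightarrow> d p q \<le> hellinger \<mu> p q"
    and balls: "convex_balls \<mu> d"
    and S: "S \<subseteq> prob_densities \<mu>" and \<delta>: "0 < \<delta>" "\<epsilon>\<^sub>0 \<le> \<delta>" and n: "0 < n"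
    and entropy: "(SUP \<epsilon>\<in>{\<epsilon>\<^sub>0..}. ln_enat (covering_number (\<epsilon> / 3) (metric_nbhd d p0 S (2 * \<epsilon>)) d)) \<le> ereal a"
  defines "b \<equiv> real n * \<delta>\<^sup>2 / 18"
  obtains A where "A \<in> sets (iid (density \<mu> p0) n)"
    "emeasure (iid (density \<mu> p0) n) A \<le> ennreal (exp (a - b) / (1 - exp (- b)))"
    "\<And>p. p \<in> S \<Longrightarrow> \<delta> \<le> d p p0 \<Longrightarrow>
      type_II_error (density \<mu> p0) n (\<lambda>x. p x / p0 x) A
        \<le> ennreal (exp (- b))"
proof -
  let ?M = "iid (density \<mu> p0) n"
  have b: "0 < b" using \<delta> n by (simp add: b_def)
  define \<epsilon> where "\<epsilon> j = 2 ^ j * \<delta>" for j :: nat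
  have \<epsilon>: "0 < \<epsilon> j" "\<epsilon>\<^sub>0 \<le> \<epsilon> j" for j
  proof -
    have "1 * \<delta> \<le> 2 ^ j * \<delta>" using \<delta> by (intro mult_right_mono) auto
    then show "0 < \<epsilon> j" "\<epsilon>\<^sub>0 \<le> \<epsilon> j" unfolding \<epsilon>_def using \<delta> by linarith+
  qed
  have ent: "ln_enat (covering_number (\<epsilon> j / 3) (metric_nbhd d p0 S (2 * \<epsilon> j)) d) \<le> ereal a" for j
    using entropy by (rule SUP_le_iff[THEN iffD1, rule_format]) (use \<epsilon> in auto)
  have "\<forall>j. \<exists>A. A \<in> sets ?M \<and> emeasure ?M A \<le> ennreal (exp a * exp (- (real n * (\<epsilon> j)\<^sup>2 / 18))) \<and>
      (\<forall>p\<in>S. \<epsilon> j \<le> d p p0 \<longrightarrow> d p p0 \<le> 2 * \<epsilon> j \<longrightarrow>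
        type_II_error (density \<mu> p0) n (\<lambda>x. p x / p0 x) A
          \<le> ennreal (exp (- (real n * (\<epsilon> j)\<^sup>2 / 18))))" (is "\<forall>j. \<exists>A. ?Q j A")
  proof
    fix j
    show "\<exists>A. ?Q j A"
    proof (rule shell_test[of p0 \<mu> d S "\<epsilon> j" a n])
      fix A assume "A \<in> sets ?M" "emeasure ?M A \<le> ennreal (exp a * exp (- (real n * (\<epsilon> j)\<^sup>2 / 18)))"
        "\<And>p. p \<in> S \<Longrightarrow> \<epsilon> j \<le> d p p0 \<Longrightarrow> d p p0 \<le> 2 * \<epsilon> j \<Longrightarrow>
          type_II_error (density \<mu> p0) n (\<lambda>x. p x / p0 x) A \<le> ennreal (exp (- (real n * (\<epsilon> j)\<^sup>2 / 18)))"
      then show ?thesis by blast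
    qed (fact p0 d hell balls S \<epsilon>(1) ent)+
  qed
  from choice[OF this] obtain T where T: "\<And>j. T j \<in> sets ?M"
    "\<And>j. emeasure ?M (T j) \<le> ennreal (exp a * exp (- (real n * (\<epsilon> j)\<^sup>2 / 18)))"
    "\<And>j p. p \<in> S \<Longrightarrow> \<epsilon> j \<le> d p p0 \<Longrightarrow> d p p0 \<le> 2 * \<epsilon> j \<Longrightarrow>
        type_II_error (density \<mu> p0) n (\<lambda>x. p x / p0 x) (T j)
          \<le> ennreal (exp (- (real n * (\<epsilon> j)\<^sup>2 / 18)))"
    by blast
  \<comment> \<open>Weakening \<open>4 ^ j\<close> to \<open>1 + j\<close> replaces the fast decay
    by a geometric series with a closed sum.\<close>
  have decay: "exp (- (real n * (\<epsilon> j)\<^sup>2 / 18)) \<le> exp (- b) * exp (- b) ^ j" for j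
  proof -
    have "1 + real j * 3 \<le> (1 + 3) ^ j" by (rule Bernoulli_inequality) auto
    then have "b * (1 + real j) \<le> b * 4 ^ j" using b by (intro mult_left_mono) auto
    also have "b * 4 ^ j = real n * (\<epsilon> j)\<^sup>2 / 18"
    proof -
      have "(2 ^ j)\<^sup>2 = (4::real) ^ j" by (simp add: power2_eq_square flip: power_mult_distrib)
      then show ?thesis by (simp add: b_def \<epsilon>_def power_mult_distrib)
    qed
    finally have "exp (- (real n * (\<epsilon> j)\<^sup>2 / 18)) \<le> exp (- (b * (1 + real j)))" by simp
    also have "\<dots> = exp (- b) * exp (- b) ^ j"
      by (simp add: exp_add[symmetric] exp_of_nat_mult[symmetric] algebra_simps)
    finally show ?thesis .
  qed
  show thesis
  proof (rule that[of "\<Union>j. T j"])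
    show "(\<Union>j. T j) \<in> sets ?M" using T(1) by auto
    have "emeasure ?M (\<Union>j. T j) \<le> (\<Sum>j. emeasure ?M (T j))"
      by (rule emeasure_subadditive_countably) (use T(1) in auto)
    also have "\<dots> \<le> (\<Sum>j. ennreal (exp (a - b) * exp (- b) ^ j))"
    proof (rule suminf_le)
      fix j
      have "exp a * exp (- (real n * (\<epsilon> j)\<^sup>2 / 18)) \<le> exp a * (exp (- b) * exp (- b) ^ j)"
        by (intro mult_left_mono decay) auto
      then show "emeasure ?M (T j) \<le> ennreal (exp (a - b) * exp (- b) ^ j)"
        using T(2)[of j] by (auto simp: exp_diff exp_minus field_simps intro: order_trans ennreal_leI)
    qed auto
    also have "\<dots> = ennreal (exp (a - b) * (1 / (1 - exp (- b))))"
    proof (rule suminf_ennreal_eq)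
      show "(\<lambda>j. exp (a - b) * exp (- b) ^ j) sums (exp (a - b) * (1 / (1 - exp (- b))))"
        using b by (intro sums_mult geometric_sums) simp
    qed simp
    finally show "emeasure ?M (\<Union>j. T j) \<le> ennreal (exp (a - b) / (1 - exp (- b)))" by simp
    fix p assume p: "p \<in> S" "\<delta> \<le> d p p0"
    obtain j where j: "\<epsilon> j \<le> d p p0" "d p p0 \<le> 2 * \<epsilon> j"
      using dyadic_shell[OF \<delta>(1) p(2)] unfolding \<epsilon>_def by blast
    have "type_II_error (density \<mu> p0) n (\<lambda>x. p x / p0 x) (\<Union>j. T j)
        \<le> type_II_error (density \<mu> p0) n (\<lambda>x. p x / p0 x) (T j)"
      by (intro type_II_error_antimono) auto
    also have "\<dots> \<le> ennreal (exp (- (real n * (\<epsilon> j)\<^sup>2 / 18)))" by (rule T(3)[OF p(1) j])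
    also have "\<dots> \<le> ennreal (exp (- b))"
    proof (rule ennreal_leI)
      have "exp (- b) * exp (- b) ^ j \<le> exp (- b)"
        using b by (intro mult_left_le power_le_one) auto
      with decay[of j] show "exp (- (real n * (\<epsilon> j)\<^sup>2 / 18)) \<le> exp (- b)" by (rule order_trans)
    qed
    finally show "type_II_error (density \<mu> p0) n (\<lambda>x. p x / p0 x) (\<Union>j. T j) \<le> ennreal (exp (- b))" .
  qed
qed

section \<open>Marginal likelihoods and the Bayes factor\<close>

lemma borel_measurable_likelihood_ratio:
  assumes p0: "p0 \<in> prob_densities \<mu>"
    and joint: "(\<lambda>(x, p). p x) \<in> borel_measurable (\<mu> \<Otimes>\<^sub>M Q)"
  shows "(\<lambda>(x, p). p x / p0 x) \<in> borel_measurable (density \<mu> p0 \<Otimes>\<^sub>M Q)"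
proof -
  have "(\<lambda>z. p0 (fst z)) \<in> borel_measurable (\<mu> \<Otimes>\<^sub>M Q)"
    using measurable_compose[OF measurable_fst prob_densitiesD(1)[OF p0]] .
  with joint have "(\<lambda>z. (\<lambda>(x, p). p x) z / p0 (fst z)) \<in> borel_measurable (\<mu> \<Otimes>\<^sub>M Q)"
    by (rule borel_measurable_divide)
  moreover have "sets (density \<mu> p0 \<Otimes>\<^sub>M Q) = sets (\<mu> \<Otimes>\<^sub>M Q)"
    by (rule sets_pair_measure_cong) auto
  ultimately show ?thesis
    by (simp add: split_beta' cong: measurable_cong_sets)
qed

text \<open>The factor in front is the same for every prior, so comparing marginal likelihoods
  amounts to comparing integrated likelihood ratios.\<close>

lemma marginal_likelihood_eq:
  assumes p0: "p0 \<in> prob_densities \<mu>"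
    and joint: "(\<lambda>(x, p). p x) \<in> borel_measurable (\<mu> \<Otimes>\<^sub>M Q)"
    and x: "x \<in> space (iid (density \<mu> p0) n)" "\<And>i. i < n \<Longrightarrow> 0 < p0 (x i)"
  shows "marginal_likelihood Q n x =
    ennreal (\<Prod>i<n. p0 (x i)) * (\<integral>\<^sup>+p. ennreal (\<Prod>i<n. p (x i) / p0 (x i)) \<partial>Q)"
proof -
  have pos: "0 < (\<Prod>i<n. p0 (x i))" using x(2) by (intro prod_pos) auto
  have "(\<lambda>p. \<Prod>i<n. p (x i) / p0 (x i)) \<in> borel_measurable Q"
    using measurable_compose[OF measurable_Pair1'[OF x(1)]
        borel_measurable_iid_prod[OF borel_measurable_likelihood_ratio[OF p0 joint]]] by simp
  then have "ennreal (\<Prod>i<n. p0 (x i)) * (\<integral>\<^sup>+p. ennreal (\<Prod>i<n. p (x i) / p0 (x i)) \<partial>Q)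
      = (\<integral>\<^sup>+p. ennreal (\<Prod>i<n. p0 (x i)) * ennreal (\<Prod>i<n. p (x i) / p0 (x i)) \<partial>Q)"
    by (intro nn_integral_cmult[symmetric]) auto
  also have "\<dots> = marginal_likelihood Q n x"
    unfolding marginal_likelihood_def
  proof (rule nn_integral_cong)
    fix p
    have "(\<Prod>i<n. p0 (x i)) * (\<Prod>i<n. p (x i) / p0 (x i)) = (\<Prod>i<n. p0 (x i) * (p (x i) / p0 (x i)))"
      by (rule prod.distrib[symmetric])
    also have "\<dots> = (\<Prod>i<n. p (x i))"
    proof (rule prod.cong)
      fix i assume "i \<in> {..<n}"
      then show "p0 (x i) * (p (x i) / p0 (x i)) = p (x i)" using x(2)[of i] by simp
    qed simp
    finally show "ennreal (\<Prod>i<n. p0 (x i)) * ennreal (\<Prod>i<n. p (x i) / p0 (x i)) = ennreal (\<Prod>i<n. p (x i))"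
      using pos by (simp flip: ennreal_mult')
  qed
  finally show ?thesis by simp
qed

lemma borel_measurable_marginal_likelihood:
  assumes "prob_space Q" and joint: "(\<lambda>(x, p). p x) \<in> borel_measurable (\<mu> \<Otimes>\<^sub>M Q)"
  shows "marginal_likelihood Q n \<in> borel_measurable (iid (density \<mu> p0) n)"
proof -
  interpret Q: prob_space Q by fact
  have "sets (density \<mu> p0 \<Otimes>\<^sub>M Q) = sets (\<mu> \<Otimes>\<^sub>M Q)"
    by (rule sets_pair_measure_cong) auto
  then have "(\<lambda>(x, p). p x) \<in> borel_measurable (density \<mu> p0 \<Otimes>\<^sub>M Q)"
    using joint by (simp cong: measurable_cong_sets)
  from measurable_compose[OF borel_measurable_iid_prod[OF this] measurable_ennreal]
  have "(\<lambda>(x, p). ennreal (\<Prod>i<n. p (x i))) \<in> borel_measurable (iid (density \<mu> p0) n \<Otimes>\<^sub>M Q)"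
    by (simp add: split_beta')
  then show ?thesis
    unfolding marginal_likelihood_def[abs_def] by (rule Q.borel_measurable_nn_integral)
qed

lemma borel_measurable_bayes_factor:
  assumes "prob_space (Q 1)" "prob_space (Q 2)"
    and "(\<lambda>(x, p). p x) \<in> borel_measurable (\<mu> \<Otimes>\<^sub>M Q 1)" "(\<lambda>(x, p). p x) \<in> borel_measurable (\<mu> \<Otimes>\<^sub>M Q 2)"
  shows "bayes_factor w Q n \<in> borel_measurable (iid (density \<mu> p0) n)"
proof -
  note [measurable] = borel_measurable_marginal_likelihood[OF assms(1,3)] borel_measurable_marginal_likelihood[OF assms(2,4)]
  show ?thesis unfolding bayes_factor_def[abs_def] by measurable
qed

text \<open>Both claims are instances: \<open>Q\<close> is the model to be beaten, tested at
  distance \<open>\<delta>\<close>, and \<open>Q'\<close> the one with Kullback-Leibler mass. The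
  summands are the first error, the failure of the evidence bound, and the second error plus the
  prior mass near \<open>p0\<close>, scaled by \<open>\<kappa>\<close> and the inverse
  evidence.\<close>

lemma marginal_likelihood_comparison:
  assumes p0: "p0 \<in> prob_densities \<mu>" and d: "density_metric \<mu> d"
    and hell: "\<And>p q. p \<in> prob_densities \<mu> \<Longrightarrow> q \<in> prob_densities \<mu> \<Longrightarrow> d p q \<le> hellinger \<mu> p q"
    and balls: "convex_balls \<mu> d" and n: "0 < n"
    and Q: "prob_space Q" "space Q \<subseteq> prob_densities \<mu>"
      "(\<lambda>(x, p). p x) \<in> borel_measurable (\<mu> \<Otimes>\<^sub>M Q)"
    and \<delta>: "0 < \<delta>" "\<epsilon>\<^sub>0 \<le> \<delta>"
    and entropy: "(SUP \<epsilon>\<in>{\<epsilon>\<^sub>0..}. ln_enat (covering_number (\<epsilon> / 3) (metric_nbhd d p0 (space Q) (2 * \<epsilon>)) d)) \<le> ereal a"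
    and C: "C \<in> sets Q" "\<And>p. p \<in> space Q \<Longrightarrow> p \<notin> C \<Longrightarrow> \<delta> \<le> d p p0"
    and Q': "prob_space Q'" "(\<lambda>(x, p). p x) \<in> borel_measurable (\<mu> \<Otimes>\<^sub>M Q')"
    and prior: "ennreal (exp (- real n * e\<^sup>2)) \<le> emeasure Q' (KL_nbhd \<mu> p0 S' e)"
    and K: "0 < K"
  defines "b \<equiv> real n * \<delta>\<^sup>2 / 18"
  shows "emeasure (iid (density \<mu> p0) n) {x \<in> space (iid (density \<mu> p0) n).
      marginal_likelihood Q' n x \<le> \<kappa> * marginal_likelihood Q n x}
    \<le> ennreal (exp (a - b) / (1 - exp (- b))) + ennreal (2 / K)
      + \<kappa> * ennreal (2 * exp (3 * (real n * e\<^sup>2) + K)) * (ennreal (exp (- b)) + emeasure Q C)"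
proof -
  interpret prob_space "density \<mu> p0" by (rule prob_space_density_prob_densities[OF p0])
  let ?M = "iid (density \<mu> p0) n"
  define R where "R Q x = (\<integral>\<^sup>+p. ennreal (\<Prod>i<n. p (x i) / p0 (x i)) \<partial>Q)" for Q x
  have R_meas: "R Q \<in> borel_measurable ?M"
    if "prob_space Q" "(\<lambda>(x, p). p x) \<in> borel_measurable (\<mu> \<Otimes>\<^sub>M Q)" for Q
  proof -
    interpret Q: prob_space Q by fact
    have "(\<lambda>(x, p). ennreal (\<Prod>i<n. p (x i) / p0 (x i))) \<in> borel_measurable (?M \<Otimes>\<^sub>M Q)"
      using measurable_compose[OF borel_measurable_iid_prod[OF borel_measurable_likelihood_ratio[OF p0 that(2)]] measurable_ennreal]
      by (simp add: split_beta')
    then show ?thesis unfolding R_def[abs_def] by (rule Q.borel_measurable_nn_integral)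
  qed
  note [measurable] = R_meas[OF Q(1,3)] R_meas[OF Q'] borel_measurable_marginal_likelihood[OF Q(1,3)]
    borel_measurable_marginal_likelihood[OF Q']
  obtain A where A: "A \<in> sets ?M" "emeasure ?M A \<le> ennreal (exp (a - b) / (1 - exp (- b)))"
    "\<And>p. p \<in> space Q \<Longrightarrow> \<delta> \<le> d p p0 \<Longrightarrow> type_II_error (density \<mu> p0) n (\<lambda>x. p x / p0 x) A \<le> ennreal (exp (- b))"
    unfolding b_def
  proof (rule model_test[of p0 \<mu> d "space Q" \<delta> \<epsilon>\<^sub>0 n a])
  qed (rule p0 d balls Q(2) \<delta> n entropy | (rule hell; assumption) | blast)+
  define B where "B = KL_nbhd \<mu> p0 S' e"
  \<comment> \<open>The exponent 3 combines the 2 of \<open>evidence_lower_bound\<close> with the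
    exponent of the prior mass of \<open>B\<close>.\<close>
  define \<theta> where "\<theta> = exp (- 3 * (real n * e\<^sup>2) - K) / 2"
  \<comment> \<open>Sets outside the sigma-algebra have \<open>emeasure\<close> 0, so the positive
    lower bound on the prior mass already forces \<open>B\<close> to be measurable.\<close>
  have "emeasure Q' B \<noteq> 0"
    using prior less_le_trans[of 0 "ennreal (exp (- real n * e\<^sup>2))"] by (auto simp: B_def)
  then have B: "B \<in> sets Q'" by (rule contrapos_np) (rule emeasure_notin_sets)
  have low: "emeasure ?M {x \<in> space ?M. R Q' x < ennreal \<theta>} \<le> ennreal (2 / K)"
  proof -
    have "ennreal \<theta> = ennreal (exp (- 2 * (real n * e\<^sup>2) - K) / 2) * ennreal (exp (- real n * e\<^sup>2))"
      by (simp add: \<theta>_def ennreal_mult[symmetric] exp_add[symmetric])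
    also have "\<dots> \<le> ennreal (exp (- 2 * (real n * e\<^sup>2) - K) / 2) * emeasure Q' B"
      using prior by (intro mult_left_mono) (auto simp: B_def)
    finally have "emeasure ?M {x \<in> space ?M. R Q' x < ennreal \<theta>} \<le>
        emeasure ?M {x \<in> space ?M. R Q' x < ennreal (exp (- 2 * (real n * e\<^sup>2) - K) / 2) * emeasure Q' B}"
      by (intro emeasure_mono) (auto intro: less_le_trans)
    also have "\<dots> \<le> ennreal (2 / K)"
      unfolding R_def
    proof (rule evidence_lower_bound[OF Q'(1) borel_measurable_likelihood_ratio[OF p0 Q'(2)] B _ _ _ K])
      fix p assume "p \<in> B"
      then have p: "AE x in density \<mu> p0. 0 < p x" "- (\<integral>x. ln (p x / p0 x) \<partial>density \<mu> p0) \<le> e\<^sup>2"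
        "(\<integral>\<^sup>+x. ennreal ((ln (p x / p0 x))\<^sup>2) \<partial>density \<mu> p0) \<le> ennreal (e\<^sup>2)"
        by (auto simp: B_def KL_nbhd_def)
      show "AE x in density \<mu> p0. 0 < p x / p0 x"
        using p(1) AE_density_pos[OF p0] by eventually_elim simp
      show "- (\<integral>x. ln (p x / p0 x) \<partial>density \<mu> p0) \<le> e\<^sup>2"
        "(\<integral>\<^sup>+x. ennreal ((ln (p x / p0 x))\<^sup>2) \<partial>density \<mu> p0) \<le> ennreal (e\<^sup>2)" by fact+
    qed
    finally show ?thesis .
  qed
  have "emeasure ?M {x \<in> space ?M. marginal_likelihood Q' n x \<le> \<kappa> * marginal_likelihood Q n x}
      \<le> emeasure ?M {x \<in> space ?M. R Q' x \<le> \<kappa> * R Q x}"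
  proof (rule emeasure_mono_AE)
    show "AE x in ?M. x \<in> {x \<in> space ?M. marginal_likelihood Q' n x \<le> \<kappa> * marginal_likelihood Q n x} \<longrightarrow>
        x \<in> {x \<in> space ?M. R Q' x \<le> \<kappa> * R Q x}"
      using AE_iid[OF AE_density_pos[OF p0]] AE_space
    proof eventually_elim
      case (elim x)
      define l where "l = ennreal (\<Prod>i<n. p0 (x i))"
      have l: "l \<noteq> 0" "l \<noteq> top"
        using elim(1) prod_pos[of "{..<n}" "\<lambda>i. p0 (x i)"] by (auto simp: l_def ennreal_eq_0_iff)
      have "marginal_likelihood Q' n x = l * R Q' x" "marginal_likelihood Q n x = l * R Q x"
        unfolding l_def R_def using elim by (auto intro!: marginal_likelihood_eq p0 Q Q')
      then show ?case
        using ennreal_mult_le_mult_iff[OF l, of "R Q' x" "\<kappa> * R Q x"] by (simp add: ac_simps)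
    qed
  qed measurable
  also have "\<dots> \<le> emeasure ?M A + ennreal (2 / K) + \<kappa> * ennreal (1 / \<theta>) * (ennreal (exp (- b)) + emeasure Q C)"
    unfolding R_def[of Q]
  proof (rule integrated_ratio_dominance[OF Q(1) borel_measurable_likelihood_ratio[OF p0 Q(3)] _ _ A(1) C(1) _ _ low])
    show "0 \<le> p x / p0 x" if "p \<in> space Q" "x \<in> space (density \<mu> p0)" for p x
      using that Q(2) prob_densitiesD(2)[of p \<mu> x] prob_densitiesD(2)[OF p0, of x] by auto
    show "(\<integral>\<^sup>+x. ennreal (p x / p0 x) \<partial>density \<mu> p0) \<le> 1" if "p \<in> space Q" for p
      using that Q(2) by (intro nn_integral_likelihood_ratio_le_1 p0) auto
    show "type_II_error (density \<mu> p0) n (\<lambda>x. p x / p0 x) A \<le> ennreal (exp (- b))"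
      if "p \<in> space Q" "p \<notin> C" for p
      using A(3) C(2) that by blast
    show "0 < \<theta>" by (simp add: \<theta>_def)
  qed measurable
  also have "1 / \<theta> = 2 * exp (3 * (real n * e\<^sup>2) + K)"
  proof -
    have "- 3 * (real n * e\<^sup>2) - K = - (3 * (real n * e\<^sup>2) + K)" by simp
    then show ?thesis unfolding \<theta>_def by (simp only: exp_minus) (simp add: field_simps)
  qed
  finally show ?thesis
    by (rule order_trans) (intro add_mono A(2) order_refl)
qed

section \<open>From marginal likelihoods to limits of the Bayes factor\<close>

lemma bayes_factor_less:
  assumes l: "0 < w 1" "0 \<le> w 2" and \<eta>: "0 < \<eta>"
    and less: "ennreal (w 2 / (w 1 * \<eta>)) * marginal_likelihood (Q 2) n x < marginal_likelihood (Q 1) n x"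
  shows "bayes_factor w Q n x < ennreal \<eta>"
proof -
  let ?m1 = "marginal_likelihood (Q 1) n x" and ?m2 = "marginal_likelihood (Q 2) n x"
  show ?thesis
  \<comment> \<open>An infinite denominator makes the quotient 0 in \<open>ennreal\<close>;
    otherwise it is positive and finite, and the inequality may be divided by it.\<close>
  proof (cases "?m1 = top")
    case True
    then show ?thesis using l \<eta> by (simp add: bayes_factor_def ennreal_mult_top)
  next
    case False
    have m1: "?m1 \<noteq> 0" using less by auto
    have "ennreal (w 1 * \<eta>) * (ennreal (w 2 / (w 1 * \<eta>)) * ?m2) < ennreal (w 1 * \<eta>) * ?m1"
      using less l \<eta> by (intro ennreal_mult_strict_left_mono) auto
    also have "ennreal (w 1 * \<eta>) * (ennreal (w 2 / (w 1 * \<eta>)) * ?m2) = ennreal (w 2) * ?m2"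
      using l \<eta> by (simp add: ennreal_mult[symmetric] mult.assoc[symmetric])
    also have "ennreal (w 1 * \<eta>) * ?m1 = ennreal \<eta> * (ennreal (w 1) * ?m1)"
      using l \<eta> by (simp add: ennreal_mult ac_simps)
    finally show ?thesis
      unfolding bayes_factor_def using False m1 l
      by (subst divide_less_ennreal) (auto simp: ennreal_mult_eq_top_iff less_top[symmetric])
  qed
qed

text \<open>Here the denominator may be 0, also through \<open>w 1 = 0\<close>; the numerator is
  then positive and the quotient infinite, so the conclusion survives.\<close>

lemma less_bayes_factor:
  assumes l: "0 \<le> w 1" "0 < w 2" and k: "0 < k"
    and less: "ennreal (k * w 1 / w 2) * marginal_likelihood (Q 1) n x < marginal_likelihood (Q 2) n x"
  shows "ennreal k < bayes_factor w Q n x"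
proof -
  let ?m1 = "marginal_likelihood (Q 1) n x" and ?m2 = "marginal_likelihood (Q 2) n x"
  define a b where "a = ennreal (w 2) * ?m2" and "b = ennreal (w 1) * ?m1"
  have "ennreal (w 2) * (ennreal (k * w 1 / w 2) * ?m1) < a"
    unfolding a_def using less l by (intro ennreal_mult_strict_left_mono) auto
  also have "ennreal (w 2) * (ennreal (k * w 1 / w 2) * ?m1) = ennreal k * b"
    using l k by (simp add: b_def ennreal_mult[symmetric] mult.assoc[symmetric])
  finally have ab: "ennreal k * b < a" .
  have b_top: "b \<noteq> top" using ab k by (auto simp: ennreal_mult_top)
  have "\<not> a / b \<le> ennreal k"
  proof
    assume le: "a / b \<le> ennreal k"
    show False
    proof (cases "b = 0")
      case True
      then show False using le ab by (simp add: top_unique split: if_splits)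
    next
      case False
      then have "a = a / b * b" using b_top by (simp add: ennreal_divide_times less_top)
      also have "\<dots> \<le> ennreal k * b" by (rule mult_right_mono[OF le]) simp
      finally show False using ab by simp
    qed
  qed
  then show ?thesis by (simp add: bayes_factor_def a_def b_def not_le)
qed

lemma tendsto_one_of_eventually_ge:
  fixes f :: "nat \<Rightarrow> real"
  assumes "\<And>e. 0 < e \<Longrightarrow> \<forall>\<^sub>F n in sequentially. 1 - e \<le> f n" and "\<forall>\<^sub>F n in sequentially. f n \<le> 1"
  shows "f \<longlonglongrightarrow> 1"
proof (rule tendstoI)
  fix e :: real assume "0 < e"
  then have "\<forall>\<^sub>F n in sequentially. 1 - e / 2 \<le> f n" by (intro assms(1)) simp
  with assms(2) show "\<forall>\<^sub>F n in sequentially. dist (f n) 1 < e"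
    by eventually_elim (use \<open>0 < e\<close> in \<open>auto simp: dist_real_def\<close>)
qed

lemma (in prob_space) measure_ge_of_complement:
  assumes "emeasure M N \<le> ennreal e" "0 \<le> e" "N \<in> sets M" "G \<in> sets M" "space M - N \<subseteq> G"
  shows "1 - e \<le> measure M G"
proof -
  have "measure M N \<le> e" using assms by (simp add: emeasure_eq_measure)
  then have "1 - e \<le> measure M (space M - N)" using assms by (simp add: prob_compl)
  also have "\<dots> \<le> measure M G" using assms by (intro finite_measure_mono)
  finally show ?thesis .
qed

text \<open>In the coefficient of \<open>x\<close>, \<open>E\<close> absorbs the entropy, 4 absorbs
  the evidence bound (3) and the prior odds (1), and \<open>L\<close> leaves a surplus of at least
  \<open>L * c\<close> independent of \<open>n\<close>. The condition that
  \<open>exp (- (L * c))\<close> is at most 1/2 keeps the geometric denominator at least 1/2, hence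
  the factor 2.\<close>

lemma test_error_bounds:
  fixes a b c x E L :: real
  assumes "0 < c" "c \<le> x" "a \<le> E * x" "0 \<le> E" "0 \<le> L" "(E + 4 + L) * x \<le> b" "exp (- (L * c)) \<le> 1 / 2"
  shows "exp (a - b) / (1 - exp (- b)) \<le> 2 * exp (- (L * c))" "exp (4 * x - b) \<le> exp (- (L * c))"
proof -
  have Lx: "L * c \<le> L * x" and Ex: "0 \<le> E * x" using assms by (auto intro: mult_left_mono)
  have "E * x + 4 * x + L * x \<le> b" using assms(6) by (simp add: algebra_simps)
  then have le: "a - b \<le> - (L * c)" "4 * x - b \<le> - (L * c)" "- b \<le> - (L * c)"
    using Lx Ex assms(1-3) by linarith+
  show "exp (4 * x - b) \<le> exp (- (L * c))" using le by simp
  have half: "1 / 2 \<le> 1 - exp (- b)" using le(3) assms(7) exp_le_cancel_iff[of "- b" "- (L * c)"] by linarith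
  have "exp (a - b) / (1 - exp (- b)) \<le> exp (- (L * c)) / (1 / 2)"
    using le(1) half by (intro frac_le) auto
  then show "exp (a - b) / (1 - exp (- b)) \<le> 2 * exp (- (L * c))" by simp
qed

lemma obtain_small_exp:
  fixes c y :: real
  assumes "0 < c" "0 < y" "y < 1"
  obtains L where "0 \<le> L" "exp (- (L * c)) = y"
  using assms by (intro that[of "- ln y / c"]) (auto simp: divide_nonpos_pos)

theorem corollary3p1:
  fixes \<mu> :: "'a measure"
    and p0 :: "'a \<Rightarrow> real"
    and d :: "('a \<Rightarrow> real) \<Rightarrow> ('a \<Rightarrow> real) \<Rightarrow> real"
    and P :: "nat \<Rightarrow> nat \<Rightarrow> ('a \<Rightarrow> real) set"
    and Prior :: "nat \<Rightarrow> nat \<Rightarrow> ('a \<Rightarrow> real) measure"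
    and lam :: "nat \<Rightarrow> nat \<Rightarrow> real"
    and eps :: "nat \<Rightarrow> nat \<Rightarrow> real"
    and E :: "nat \<Rightarrow> real"
    and c :: real
  assumes p0: "p0 \<in> prob_densities \<mu>"
    and d_metric: "density_metric \<mu> d"
    and d_le_hellinger:
      "\<And>p q. p \<in> prob_densities \<mu> \<Longrightarrow> q \<in> prob_densities \<mu> \<Longrightarrow> d p q \<le> hellinger \<mu> p q"
    and d_convex_balls: "convex_balls \<mu> d"
    and models:
      "\<And>n \<alpha>. n \<ge> 1 \<Longrightarrow> \<alpha> \<in> {1, 2} \<Longrightarrow> P n \<alpha> \<subseteq> prob_densities \<mu>"
    and priors:
      "\<And>n \<alpha>. n \<ge> 1 \<Longrightarrow> \<alpha> \<in> {1, 2} \<Longrightarrow> prob_space (Prior n \<alpha>)"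
      "\<And>n \<alpha>. n \<ge> 1 \<Longrightarrow> \<alpha> \<in> {1, 2} \<Longrightarrow> space (Prior n \<alpha>) = P n \<alpha>"
      "\<And>n \<alpha>. n \<ge> 1 \<Longrightarrow> \<alpha> \<in> {1, 2} \<Longrightarrow>
         (\<lambda>(x, p). p x) \<in> borel_measurable (\<mu> \<Otimes>\<^sub>M Prior n \<alpha>)"
    and weights:
      "\<And>n. n \<ge> 1 \<Longrightarrow> 0 \<le> lam n 1 \<and> 0 \<le> lam n 2 \<and> lam n 1 + lam n 2 = 1"
    and eps_pos: "\<And>n \<alpha>. n \<ge> 1 \<Longrightarrow> \<alpha> \<in> {1, 2} \<Longrightarrow> 0 < eps n \<alpha>"
    and eps_lim: "\<And>\<alpha>. \<alpha> \<in> {1, 2} \<Longrightarrow> (\<lambda>n. eps n \<alpha>) \<longlonglongrightarrow> 0"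
    and eps_rate: "0 < c" "\<And>n. n \<ge> 1 \<Longrightarrow> c \<le> real n * (eps n 1)\<^sup>2"
    and eps_order: "\<And>n. n \<ge> 1 \<Longrightarrow> eps n 1 > eps n 2"
    and E_pos: "\<And>\<alpha>. \<alpha> \<in> {1, 2} \<Longrightarrow> 0 < E \<alpha>"
    and entropy:
      "\<And>n \<alpha>. n \<ge> 1 \<Longrightarrow> \<alpha> \<in> {1, 2} \<Longrightarrow>
         (SUP \<epsilon>\<in>{eps n \<alpha>..}.
            ln_enat (covering_number (\<epsilon> / 3) (metric_nbhd d p0 (P n \<alpha>) (2 * \<epsilon>)) d))
         \<le> ereal (E \<alpha> * real n * (eps n \<alpha>)\<^sup>2)"
  shows
    "((\<forall>n\<ge>1. emeasure (Prior n 1) (KL_nbhd \<mu> p0 (P n 1) (eps n 1))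
                \<ge> ennreal (exp (- real n * (eps n 1)\<^sup>2))) \<and>
      (\<forall>n\<ge>1. prior_odds (lam n) \<le> ennreal (exp (real n * (eps n 1)\<^sup>2))) \<and>
      (\<exists>I. filterlim I at_top sequentially \<and>
           (\<forall>n\<ge>1. dist_to_set d p0 (P n 2) \<ge> I n * eps n 1))
      \<longrightarrow> tendsto_zero_in_prob (sample_measure \<mu> p0)
            (\<lambda>n. bayes_factor (lam n) (Prior n) n))
     \<and>
     ((\<forall>n\<ge>1. emeasure (Prior n 2) (KL_nbhd \<mu> p0 (P n 2) (eps n 2))
                \<ge> ennreal (exp (- real n * (eps n 2)\<^sup>2))) \<and>
      (\<forall>n\<ge>1. prior_odds (lam n) \<ge> ennreal (exp (- real n * (eps n 1)\<^sup>2))) \<and>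
      (\<forall>I>0. \<exists>r. r \<in> o(\<lambda>n. exp (- 3 * real n * (eps n 2)\<^sup>2)) \<and>
         (\<forall>n\<ge>1. metric_nbhd d p0 (P n 1) (I * eps n 1) \<in> sets (Prior n 1) \<and>
                 emeasure (Prior n 1) (metric_nbhd d p0 (P n 1) (I * eps n 1))
                   \<le> prior_odds (lam n) * ennreal (r n)))
      \<longrightarrow> tendsto_infinity_in_prob (sample_measure \<mu> p0)
            (\<lambda>n. bayes_factor (lam n) (Prior n) n))"
proof (intro conjI impI)
  let ?M = "\<lambda>n. iid (density \<mu> p0) n"
  have E_pos': "0 < E 1" "0 < E 2" using E_pos by auto
  have M: "prob_space (?M n)" for n
    using prob_space.prob_space_iid[OF prob_space_density_prob_densities[OF p0]] .
  have pr: "prob_space (Prior n \<alpha>)" "space (Prior n \<alpha>) = P n \<alpha>" "P n \<alpha> \<subseteq> prob_densities \<mu>"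
    "(\<lambda>(x, p). p x) \<in> borel_measurable (\<mu> \<Otimes>\<^sub>M Prior n \<alpha>)" "0 < eps n \<alpha>"
    "(SUP \<epsilon>\<in>{eps n \<alpha>..}. ln_enat (covering_number (\<epsilon> / 3) (metric_nbhd d p0 (space (Prior n \<alpha>)) (2 * \<epsilon>)) d))
      \<le> ereal (E \<alpha> * (real n * (eps n \<alpha>)\<^sup>2))"
    if "n \<ge> 1" "\<alpha> \<in> {1, 2}" for n \<alpha>
    using that priors models eps_pos entropy by (auto simp: mult.assoc)
  have BF_meas: "bayes_factor (lam n) (Prior n) n \<in> borel_measurable (?M n)" if "n \<ge> 1" for n
    using that by (intro borel_measurable_bayes_factor pr) auto
  have marginal_meas: "marginal_likelihood (Prior n \<alpha>) n \<in> borel_measurable (?M n)" if "n \<ge> 1" "\<alpha> \<in> {1, 2}" for n \<alpha>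
    using that by (intro borel_measurable_marginal_likelihood pr)
  have eps2_le: "real n * (eps n 2)\<^sup>2 \<le> real n * (eps n 1)\<^sup>2" if n: "n \<ge> 1" for n
    using eps_order[OF n] pr(5)[OF n, of 2] by (intro mult_left_mono power_mono) auto
  note comparison = marginal_likelihood_comparison[where \<mu>=\<mu> and ?p0.0=p0 and d=d]
  {
    assume "(\<forall>n\<ge>1. emeasure (Prior n 1) (KL_nbhd \<mu> p0 (P n 1) (eps n 1)) \<ge> ennreal (exp (- real n * (eps n 1)\<^sup>2))) \<and>
      (\<forall>n\<ge>1. prior_odds (lam n) \<le> ennreal (exp (real n * (eps n 1)\<^sup>2))) \<and>
      (\<exists>I. filterlim I at_top sequentially \<and> (\<forall>n\<ge>1. dist_to_set d p0 (P n 2) \<ge> I n * eps n 1))"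
    then obtain I where mass: "\<And>n. n \<ge> 1 \<Longrightarrow> ennreal (exp (- real n * (eps n 1)\<^sup>2)) \<le> emeasure (Prior n 1) (KL_nbhd \<mu> p0 (P n 1) (eps n 1))"
      and odds: "\<And>n. n \<ge> 1 \<Longrightarrow> prior_odds (lam n) \<le> ennreal (exp (real n * (eps n 1)\<^sup>2))"
      and I: "filterlim I at_top sequentially" and far: "\<And>n. n \<ge> 1 \<Longrightarrow> I n * eps n 1 \<le> dist_to_set d p0 (P n 2)"
      by blast
    show "tendsto_zero_in_prob (sample_measure \<mu> p0) (\<lambda>n. bayes_factor (lam n) (Prior n) n)"
      unfolding tendsto_zero_in_prob_def sample_measure_def
    proof (intro allI impI tendsto_one_of_eventually_ge)
      fix \<eta> e :: real assume \<eta>: "0 < \<eta>" and e: "0 < e"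
      \<comment> \<open>Makes the evidence failure \<open>2 / K\<close> equal to
        \<open>e / 4\<close>.\<close>
      define K where "K = 8 / e"
      have K: "0 < K" using e by (simp add: K_def)
      \<comment> \<open>The entries serve, in order, \<open>test_error_bounds\<close>, the first
        error \<open>2 * y\<close>, and the second error after multiplication by
        \<open>2 / \<eta> * exp K\<close>.\<close>
      define y where "y = min (1 / 2) (min (e / 8) (e * \<eta> / (8 * exp K)))"
      have y: "0 < y" "y < 1" "y \<le> 1 / 2" "2 * y \<le> e / 4" "2 / \<eta> * exp K * y \<le> e / 4"
      proof -
        show "0 < y" "y < 1" "y \<le> 1 / 2" "2 * y \<le> e / 4" using e \<eta> by (auto simp: y_def)
        have "y \<le> e * \<eta> / (8 * exp K)" by (simp add: y_def)
        then have "2 / \<eta> * exp K * y \<le> 2 / \<eta> * exp K * (e * \<eta> / (8 * exp K))" using \<eta> by (intro mult_left_mono) auto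
        also have "\<dots> = e / 4" using \<eta> by (simp add: field_simps)
        finally show "2 / \<eta> * exp K * y \<le> e / 4" .
      qed
      obtain L where L: "0 \<le> L" "exp (- (L * c)) = y" using obtain_small_exp[OF eps_rate(1) y(1,2)] .
      \<comment> \<open>The factor 18 cancels the denominator of \<open>b\<close>; since
        \<open>I n\<close> is then at least 1, its square is at least as large.\<close>
      have "\<forall>\<^sub>F n in sequentially. 18 * (E 2 + 4 + L) \<le> I n"
        using I by (simp add: filterlim_at_top)
      moreover have "\<forall>\<^sub>F n in sequentially. n \<ge> 1" by (rule eventually_ge_at_top)
      ultimately show "\<forall>\<^sub>F n in sequentially.
          1 - e \<le> measure (?M n) {x \<in> space (?M n). bayes_factor (lam n) (Prior n) n x < ennreal \<eta>}"
      proof eventually_elim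
        case (elim n)
        then have n: "n \<ge> 1" and In: "18 * (E 2 + 4 + L) \<le> I n" by auto
        note [measurable] = BF_meas[OF n] marginal_meas[OF n, of 1, simplified] marginal_meas[OF n, of 2, simplified]
        define x where "x = real n * (eps n 1)\<^sup>2"
        define w where "w = lam n"
        have w: "0 \<le> w 1" "0 \<le> w 2" "w 1 + w 2 = 1" using weights[OF n] by (auto simp: w_def)
        have odds_n: "ennreal (w 2) / ennreal (w 1) \<le> ennreal (exp x)"
          using odds[OF n] by (simp add: prior_odds_def w_def x_def)
        \<comment> \<open>A zero weight would leave \<open>w 2 = 1\<close> and infinite prior
          odds.\<close>
        have w1: "0 < w 1"
        proof (rule ccontr)
          assume "\<not> 0 < w 1"
          then have "w 1 = 0" "w 2 = 1" using w by auto
          then show False using odds_n by (simp add: top_unique)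
        qed
        have w_ratio: "w 2 / w 1 \<le> exp x"
          using odds_n w w1 by (simp add: divide_ennreal)
        define \<delta> where "\<delta> = I n * eps n 1"
        have I1: "1 \<le> I n" using In E_pos' L by (simp add: distrib_left)
        have \<delta>: "0 < \<delta>" "eps n 2 \<le> \<delta>"
        proof -
          have "1 * eps n 1 \<le> \<delta>" unfolding \<delta>_def using I1 pr(5)[OF n, of 1] by (intro mult_right_mono) auto
          then show "0 < \<delta>" "eps n 2 \<le> \<delta>" using pr(5)[OF n, of 1] eps_order[OF n] by auto
        qed
        define b where "b = real n * \<delta>\<^sup>2 / 18"
        define a where "a = E 2 * (real n * (eps n 2)\<^sup>2)"
        have x: "c \<le> x" using eps_rate(2)[OF n] by (simp add: x_def)
        have b_ge: "(E 2 + 4 + L) * x \<le> b"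
        proof -
          have "18 * (E 2 + 4 + L) \<le> (I n)\<^sup>2"
            using In self_le_power[OF I1, of 2] by (rule order_trans) simp
          then have "18 * (E 2 + 4 + L) * x \<le> (I n)\<^sup>2 * x"
            using x eps_rate(1) by (intro mult_right_mono) auto
          also have "\<dots> = 18 * b" by (simp add: b_def \<delta>_def x_def power_mult_distrib)
          finally have "18 * ((E 2 + 4 + L) * x) \<le> 18 * b" by (simp only: mult.assoc)
          then show ?thesis by (rule mult_left_le_imp_le) simp
        qed
        have a_le: "a \<le> E 2 * x"
          unfolding a_def x_def by (rule mult_left_mono[OF eps2_le[OF n] less_imp_le[OF E_pos'(2)]])
        note bounds = test_error_bounds[OF eps_rate(1) x a_le _ L(1) b_ge, unfolded L(2)]
        have bound1: "exp (a - b) / (1 - exp (- b)) \<le> 2 * y" and bound2: "exp (4 * x - b) \<le> y"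
          using bounds E_pos' y by auto
        \<comment> \<open>The threshold of \<open>bayes_factor_less\<close>, so that the Bayes
          factor is below \<open>\<eta>\<close> off \<open>?N\<close>. The exceptional set of the
          comparison is \<open>{}\<close>, as no point of model 2 is within less than
          \<open>\<delta>\<close> of \<open>p0\<close>.\<close>
        define \<kappa> where "\<kappa> = w 2 / (w 1 * \<eta>)"
        have \<kappa>: "0 \<le> \<kappa>" "\<kappa> \<le> exp x / \<eta>"
          using w w1 \<eta> w_ratio divide_right_mono[OF w_ratio, of \<eta>] by (auto simp: \<kappa>_def)
        let ?N = "{x \<in> space (?M n). marginal_likelihood (Prior n 1) n x \<le> ennreal \<kappa> * marginal_likelihood (Prior n 2) n x}"
        have "emeasure (?M n) ?N \<le> ennreal (exp (a - b) / (1 - exp (- b))) + ennreal (2 / K)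
            + ennreal \<kappa> * ennreal (2 * exp (3 * (real n * (eps n 1)\<^sup>2) + K)) * (ennreal (exp (- b)) + emeasure (Prior n 2) {})"
          unfolding b_def
        proof (rule comparison)
          show "\<delta> \<le> d p p0" if "p \<in> space (Prior n 2)" for p
          proof -
            have p: "p \<in> P n 2" "p \<in> prob_densities \<mu>" using that pr[OF n, of 2] by auto
            have "dist_to_set d p0 (P n 2) \<le> d p0 p"
              unfolding dist_to_set_def
            proof (rule cINF_lower[OF _ p(1)])
              show "bdd_below (d p0 ` P n 2)"
                using density_metricD(1)[OF d_metric p0] pr(3)[OF n, of 2] by (intro bdd_belowI2[of _ 0]) auto
            qed
            then show ?thesis
              using far[OF n] density_metricD(2)[OF d_metric p0 p(2)] by (simp add: \<delta>_def)
          qed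
          show "ennreal (exp (- real n * (eps n 1)\<^sup>2)) \<le> emeasure (Prior n 1) (KL_nbhd \<mu> p0 (P n 1) (eps n 1))"
            by (rule mass[OF n])
        qed (use p0 d_metric d_le_hellinger d_convex_balls n pr[OF n] \<delta> K in \<open>auto simp: a_def\<close>)
        also have "\<dots> \<le> ennreal (e / 4) + ennreal (e / 4) + ennreal (e / 4)"
        proof (intro add_mono)
          show "ennreal (exp (a - b) / (1 - exp (- b))) \<le> ennreal (e / 4)"
            by (rule ennreal_leI[OF order_trans[OF bound1 y(4)]])
          show "ennreal (2 / K) \<le> ennreal (e / 4)" by (simp add: K_def)
          have "\<kappa> * (2 * exp (3 * x + K)) * exp (- b) \<le> exp x / \<eta> * (2 * exp (3 * x + K)) * exp (- b)"
            using \<kappa> by (intro mult_right_mono) auto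
          also have "\<dots> = 2 / \<eta> * exp K * exp (4 * x - b)"
          proof -
            have "exp x * exp (3 * x + K) * exp (- b) = exp K * exp (4 * x - b)"
              by (simp flip: exp_add)
            then show ?thesis by (simp add: field_simps)
          qed
          also have "\<dots> \<le> 2 / \<eta> * exp K * y" using \<eta> bound2 by (intro mult_left_mono) auto
          also have "\<dots> \<le> e / 4" by (rule y)
          finally have "ennreal (\<kappa> * (2 * exp (3 * x + K)) * exp (- b)) \<le> ennreal (e / 4)"
            by (rule ennreal_leI)
          then show "ennreal \<kappa> * ennreal (2 * exp (3 * (real n * (eps n 1)\<^sup>2) + K)) * (ennreal (exp (- b)) + emeasure (Prior n 2) {}) \<le> ennreal (e / 4)"
            using \<kappa> by (simp add: ennreal_mult x_def)
        qed
        also have "\<dots> \<le> ennreal e" using e by (simp flip: ennreal_plus)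
        finally have bad: "emeasure (?M n) ?N \<le> ennreal e" .
        show ?case
        proof (rule prob_space.measure_ge_of_complement[OF M bad])
          show "space (?M n) - ?N \<subseteq> {x \<in> space (?M n). bayes_factor (lam n) (Prior n) n x < ennreal \<eta>}"
            using bayes_factor_less[of w \<eta> "Prior n" n] w w1 \<eta> by (auto simp: \<kappa>_def w_def not_le)
        qed (use e in \<open>auto intro: less_imp_le\<close>)
      qed
    next
      fix \<eta> :: real
      show "\<forall>\<^sub>F n in sequentially. measure (?M n) {x \<in> space (?M n). bayes_factor (lam n) (Prior n) n x < ennreal \<eta>} \<le> 1"
        using prob_space.prob_le_1[OF M] by (intro always_eventually allI)
    qed
  }
  {
    assume hyp: "(\<forall>n\<ge>1. emeasure (Prior n 2) (KL_nbhd \<mu> p0 (P n 2) (eps n 2)) \<ge> ennreal (exp (- real n * (eps n 2)\<^sup>2))) \<and>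
      (\<forall>n\<ge>1. prior_odds (lam n) \<ge> ennreal (exp (- real n * (eps n 1)\<^sup>2))) \<and>
      (\<forall>I>0. \<exists>r. r \<in> o(\<lambda>n. exp (- 3 * real n * (eps n 2)\<^sup>2)) \<and>
         (\<forall>n\<ge>1. metric_nbhd d p0 (P n 1) (I * eps n 1) \<in> sets (Prior n 1) \<and>
                 emeasure (Prior n 1) (metric_nbhd d p0 (P n 1) (I * eps n 1)) \<le> prior_odds (lam n) * ennreal (r n)))"
    have mass: "ennreal (exp (- real n * (eps n 2)\<^sup>2)) \<le> emeasure (Prior n 2) (KL_nbhd \<mu> p0 (P n 2) (eps n 2))"
      and odds: "ennreal (exp (- real n * (eps n 1)\<^sup>2)) \<le> prior_odds (lam n)" if "n \<ge> 1" for n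
      using hyp that by auto
    show "tendsto_infinity_in_prob (sample_measure \<mu> p0) (\<lambda>n. bayes_factor (lam n) (Prior n) n)"
      unfolding tendsto_infinity_in_prob_def sample_measure_def
    proof (intro allI impI tendsto_one_of_eventually_ge)
      fix k0 e :: real assume e: "0 < e"
      \<comment> \<open>Limits above arbitrary real thresholds reduce to positive ones, as
        \<open>less_bayes_factor\<close> requires.\<close>
      define k where "k = max k0 1"
      have k: "0 < k" "k0 \<le> k" by (auto simp: k_def)
      define K where "K = 8 / e"
      have K: "0 < K" using e by (simp add: K_def)
      define y where "y = min (1 / 2) (min (e / 8) (e / (8 * k * exp K)))"
      have y: "0 < y" "y < 1" "y \<le> 1 / 2" "2 * y \<le> e / 4" "2 * k * exp K * y \<le> e / 4"
      proof -
        show "0 < y" "y < 1" "y \<le> 1 / 2" "2 * y \<le> e / 4" using e k by (auto simp: y_def)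
        have "y \<le> e / (8 * k * exp K)" by (simp add: y_def)
        then have "2 * k * exp K * y \<le> 2 * k * exp K * (e / (8 * k * exp K))" using k by (intro mult_left_mono) auto
        also have "\<dots> = e / 4" using k by (simp add: field_simps)
        finally show "2 * k * exp K * y \<le> e / 4" .
      qed
      obtain L where L: "0 \<le> L" "exp (- (L * c)) = y" using obtain_small_exp[OF eps_rate(1) y(1,2)] .
      \<comment> \<open>The radius factor is a constant here, fixed from \<open>e\<close> and
        \<open>k\<close> through \<open>L\<close>; the small-mass hypothesis is then instantiated at
        it.\<close>
      define I where "I = 18 * (E 1 + 4 + L)"
      have I1: "1 \<le> I" using E_pos' L by (simp add: I_def)
      then have "0 < I" by simp
      with hyp obtain r where r: "r \<in> o(\<lambda>n. exp (- 3 * real n * (eps n 2)\<^sup>2))"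
        and near: "\<And>n. n \<ge> 1 \<Longrightarrow> metric_nbhd d p0 (P n 1) (I * eps n 1) \<in> sets (Prior n 1)"
          "\<And>n. n \<ge> 1 \<Longrightarrow> emeasure (Prior n 1) (metric_nbhd d p0 (P n 1) (I * eps n 1)) \<le> prior_odds (lam n) * ennreal (r n)"
        by blast
      have "0 < e / (8 * k * exp K)" using e k by simp
      from landau_o.smallD[OF r this]
      have "\<forall>\<^sub>F n in sequentially. norm (r n) \<le> e / (8 * k * exp K) * norm (exp (- 3 * real n * (eps n 2)\<^sup>2))" .
      moreover have "\<forall>\<^sub>F n in sequentially. n \<ge> 1" by (rule eventually_ge_at_top)
      ultimately show "\<forall>\<^sub>F n in sequentially.
          1 - e \<le> measure (?M n) {x \<in> space (?M n). bayes_factor (lam n) (Prior n) n x > ennreal k0}"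
      proof eventually_elim
        case (elim n)
        then have n: "n \<ge> 1" by auto
        note [measurable] = BF_meas[OF n] marginal_meas[OF n, of 1, simplified] marginal_meas[OF n, of 2, simplified]
        define x where "x = real n * (eps n 1)\<^sup>2"
        define z where "z = real n * (eps n 2)\<^sup>2"
        have z: "z \<le> x" unfolding z_def x_def by (rule eps2_le[OF n])
        have r_le: "r n \<le> e / (8 * k * exp K) * exp (- 3 * z)"
          using elim(1) by (simp add: z_def mult.assoc)
        define w where "w = lam n"
        have w: "0 \<le> w 1" "0 \<le> w 2" "w 1 + w 2 = 1" using weights[OF n] by (auto simp: w_def)
        have odds_n: "ennreal (exp (- x)) \<le> ennreal (w 2) / ennreal (w 1)"
          using odds[OF n] by (simp add: prior_odds_def w_def x_def)
        have w2: "0 < w 2"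
        proof (rule ccontr)
          assume "\<not> 0 < w 2"
          then have "w 2 = 0" using w by auto
          then show False using odds_n by simp
        qed
        have w_ratio: "w 1 / w 2 \<le> exp x"
        proof (cases "w 1 = 0")
          case False
          then have "exp (- x) \<le> w 2 / w 1"
            using odds_n w w2 by (simp add: divide_ennreal)
          then have "exp (- x) * w 1 \<le> w 2" using False w by (simp add: field_simps)
          then have "exp x * (exp (- x) * w 1) \<le> exp x * w 2" by (intro mult_left_mono) auto
          then show ?thesis using w2 by (simp add: field_simps flip: exp_add mult.assoc)
        qed simp
        define \<delta> where "\<delta> = I * eps n 1"
        have \<delta>: "0 < \<delta>" "eps n 1 \<le> \<delta>"
        proof -
          have "1 * eps n 1 \<le> \<delta>" unfolding \<delta>_def using I1 pr(5)[OF n, of 1] by (intro mult_right_mono) auto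
          then show "0 < \<delta>" "eps n 1 \<le> \<delta>" using pr(5)[OF n, of 1] by auto
        qed
        define C where "C = metric_nbhd d p0 (P n 1) \<delta>"
        have C: "C \<in> sets (Prior n 1)" "emeasure (Prior n 1) C \<le> ennreal (w 2) / ennreal (w 1) * ennreal (r n)"
          using near[OF n] by (auto simp: C_def \<delta>_def w_def prior_odds_def)
        define b where "b = real n * \<delta>\<^sup>2 / 18"
        define a where "a = E 1 * x"
        have x: "c \<le> x" using eps_rate(2)[OF n] by (simp add: x_def)
        have b_ge: "(E 1 + 4 + L) * x \<le> b"
        proof -
          have "18 * (E 1 + 4 + L) \<le> I\<^sup>2"
            using self_le_power[OF I1, of 2] by (simp add: I_def)
          then have "18 * (E 1 + 4 + L) * x \<le> I\<^sup>2 * x"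
            using x eps_rate(1) by (intro mult_right_mono) auto
          also have "\<dots> = 18 * b" by (simp add: b_def \<delta>_def x_def power_mult_distrib)
          finally have "18 * ((E 1 + 4 + L) * x) \<le> 18 * b" by (simp only: mult.assoc)
          then show ?thesis by (rule mult_left_le_imp_le) simp
        qed
        note bounds = test_error_bounds[OF eps_rate(1) x eq_refl[OF a_def] _ L(1) b_ge, unfolded L(2)]
        have bound1: "exp (a - b) / (1 - exp (- b)) \<le> 2 * y" and bound2: "exp (4 * x - b) \<le> y"
          using bounds E_pos' y by auto
        define \<kappa> where "\<kappa> = k * w 1 / w 2"
        have \<kappa>: "0 \<le> \<kappa>" "\<kappa> \<le> k * exp x"
          using w w2 k mult_left_mono[OF w_ratio, of k] by (auto simp: \<kappa>_def)
        define D where "D = 2 * exp (3 * z + K)"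
        have D: "0 \<le> D" by (simp add: D_def)
        let ?N = "{x \<in> space (?M n). marginal_likelihood (Prior n 2) n x \<le> ennreal \<kappa> * marginal_likelihood (Prior n 1) n x}"
        have "emeasure (?M n) ?N \<le> ennreal (exp (a - b) / (1 - exp (- b))) + ennreal (2 / K)
            + ennreal \<kappa> * ennreal (2 * exp (3 * (real n * (eps n 2)\<^sup>2) + K)) * (ennreal (exp (- b)) + emeasure (Prior n 1) C)"
          unfolding b_def
        proof (rule comparison)
          show "\<delta> \<le> d p p0" if "p \<in> space (Prior n 1)" "p \<notin> C" for p
            using that pr(2)[OF n, of 1] by (auto simp: C_def metric_nbhd_def)
          show "ennreal (exp (- real n * (eps n 2)\<^sup>2)) \<le> emeasure (Prior n 2) (KL_nbhd \<mu> p0 (P n 2) (eps n 2))"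
            by (rule mass[OF n])
        qed (use p0 d_metric d_le_hellinger d_convex_balls n pr[OF n] \<delta> K C in \<open>auto simp: a_def x_def\<close>)
        also have "\<dots> = ennreal (exp (a - b) / (1 - exp (- b))) + ennreal (2 / K)
            + (ennreal (\<kappa> * D * exp (- b)) + ennreal \<kappa> * ennreal D * emeasure (Prior n 1) C)"
          using \<kappa> D by (simp add: distrib_left ennreal_mult D_def z_def)
        also have "\<dots> \<le> ennreal (e / 4) + ennreal (e / 4) + (ennreal (e / 4) + ennreal (e / 4))"
        proof (intro add_mono)
          show "ennreal (exp (a - b) / (1 - exp (- b))) \<le> ennreal (e / 4)"
            by (rule ennreal_leI[OF order_trans[OF bound1 y(4)]])
          show "ennreal (2 / K) \<le> ennreal (e / 4)" by (simp add: K_def)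
          \<comment> \<open>In this term the cost at scale \<open>eps n 2\<close> may be enlarged to
            \<open>x\<close>, since \<open>b\<close> dominates \<open>4 * x\<close>.\<close>
          have "\<kappa> * D * exp (- b) \<le> k * exp x * (2 * exp (3 * x + K)) * exp (- b)"
            using \<kappa> z k by (intro mult_mono) (auto simp: D_def)
          also have "\<dots> = 2 * k * exp K * exp (4 * x - b)"
          proof -
            have "exp x * exp (3 * x + K) * exp (- b) = exp K * exp (4 * x - b)"
              by (simp flip: exp_add)
            then show ?thesis by (simp add: field_simps)
          qed
          also have "\<dots> \<le> 2 * k * exp K * y" using k bound2 by (intro mult_left_mono) auto
          also have "\<dots> \<le> e / 4" by (rule y)
          finally show "ennreal (\<kappa> * D * exp (- b)) \<le> ennreal (e / 4)" by (rule ennreal_leI)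
          \<comment> \<open>No such slack is available here: \<open>\<kappa>\<close> cancels the
            prior odds up to \<open>k\<close>, and \<open>exp (3 * z)\<close> in \<open>D\<close> is
            cancelled exactly by the rate of \<open>r n\<close>, which is why that rate carries a 3.
            The constant in the bound on \<open>r n\<close> then leaves \<open>e / 4\<close>. For
            \<open>w 1 = 0\<close> the odds are infinite, but \<open>\<kappa>\<close> is 0.\<close>
          show "ennreal \<kappa> * ennreal D * emeasure (Prior n 1) C \<le> ennreal (e / 4)"
          proof (cases "w 1 = 0")
            case True
            then show ?thesis by (simp add: \<kappa>_def)
          next
            case False
            have "ennreal \<kappa> * ennreal D * emeasure (Prior n 1) C
                \<le> ennreal \<kappa> * ennreal D * (ennreal (w 2 / w 1) * ennreal (e / (8 * k * exp K) * exp (- 3 * z)))"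
            proof (rule mult_left_mono)
              have "emeasure (Prior n 1) C \<le> ennreal (w 2 / w 1) * ennreal (r n)"
                using C(2) False w by (simp add: divide_ennreal)
              also have "\<dots> \<le> ennreal (w 2 / w 1) * ennreal (e / (8 * k * exp K) * exp (- 3 * z))"
                using r_le by (intro mult_left_mono ennreal_leI) auto
              finally show "emeasure (Prior n 1) C \<le> ennreal (w 2 / w 1) * ennreal (e / (8 * k * exp K) * exp (- 3 * z))" .
            qed simp
            also have "\<dots> = ennreal (\<kappa> * D * (w 2 / w 1 * (e / (8 * k * exp K) * exp (- 3 * z))))"
            proof -
              have "ennreal \<kappa> * ennreal D * (ennreal s * ennreal t) = ennreal (\<kappa> * D * (s * t))"
                if "0 \<le> s" "0 \<le> t" for s t
                using \<kappa> D that by (simp add: ennreal_mult)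
              then show ?thesis using w e k by simp
            qed
            also have "\<kappa> * D * (w 2 / w 1 * (e / (8 * k * exp K) * exp (- 3 * z))) = e / 4"
            proof -
              have "exp (3 * z + K) * exp (- 3 * z) = exp K" by (simp flip: exp_add)
              then have "D * exp (- 3 * z) = 2 * exp K" by (simp add: D_def)
              moreover have "\<kappa> * (w 2 / w 1) = k" using False w2 by (simp add: \<kappa>_def)
              moreover have "\<kappa> * D * (w 2 / w 1 * (e / (8 * k * exp K) * exp (- 3 * z)))
                  = (\<kappa> * (w 2 / w 1)) * (D * exp (- 3 * z)) * (e / (8 * k * exp K))"
                by (simp only: ac_simps)
              ultimately show ?thesis using k by (simp add: field_simps)
            qed
            finally show ?thesis .
          qed
        qed
        also have "\<dots> = ennreal e" using e by (simp flip: ennreal_plus)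
        finally have bad: "emeasure (?M n) ?N \<le> ennreal e" .
        show ?case
        proof (rule prob_space.measure_ge_of_complement[OF M bad])
          show "space (?M n) - ?N \<subseteq> {x \<in> space (?M n). bayes_factor (lam n) (Prior n) n x > ennreal k0}"
          proof
            fix x assume x: "x \<in> space (?M n) - ?N"
            then have "ennreal (k * w 1 / w 2) * marginal_likelihood (Prior n 1) n x < marginal_likelihood (Prior n 2) n x"
              by (auto simp: \<kappa>_def not_le)
            then have "ennreal k < bayes_factor w (Prior n) n x"
              using w(1) w2 k(1) by (intro less_bayes_factor)
            moreover have "ennreal k0 \<le> ennreal k" using k by (simp add: ennreal_leI)
            ultimately show "x \<in> {x \<in> space (?M n). bayes_factor (lam n) (Prior n) n x > ennreal k0}"
              using x by (auto simp: w_def)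
          qed
        qed (use e in \<open>auto intro: less_imp_le\<close>)
      qed
    next
      fix k0 :: real
      show "\<forall>\<^sub>F n in sequentially. measure (?M n) {x \<in> space (?M n). bayes_factor (lam n) (Prior n) n x > ennreal k0} \<le> 1"
        using prob_space.prob_le_1[OF M] by (intro always_eventually allI)
    qed
  }
qed

end
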